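(* Let $F$ be an algebraically closed field and let $\mathfrak{g}=\langle x\rangle\ltimes\mathfrak{a}$ be a finite dimensional Lie algebra over $F$, where $\mathfrak{a}$ is an abelian ideal on which $\mathrm{ad}\,x$ acts diagonalizably. Let $U$ be a finite dimensional admissible uniserial $\mathfrak{g}$-module of composition length $m$ which is not annihilated by $[\mathfrak{g},\mathfrak{g}]$. Suppose that $F$ has characteristic $0$ or prime characteristic $p\ge m$. Then: (1) $m=\dim(U)>1$. (2) Let $S$ be the set of eigenvalues $\delta$ of $\mathrm{ad}\,x$ acting on $\mathfrak{a}$ such that the corresponding eigenspace $\mathfrak{a}(\delta)$ does not act trivially on $U$. Then, after replacing $x$ by a suitable scalar multiple, $1\in S$ and every element of $S$ is an integer $i$ satisfying $0\le i<m$. With $x$ so replaced: (3) For each $i\in S$ let $\mathfrak{b}(i)$ be the subspace of $\mathfrak{a}(i)$ annihilating $U$. Then $\mathfrak{b}(i)$ is a hyperplane of $\mathfrak{a}(i)$. In particular, if $U$ is faithful then every eigenvalue of $\mathrm{ad}\,x$ acting on $\mathfrak{a}$ must have multiplicity $1$. (4) Fix a non-zero $v\in\mathfrak{a}(1)$. Then there are linear functionals $f^i:\mathfrak{a}(i)\to F$, $0\le i<m$, such that $f^1(v)=1$, and a basis of $U$ relative to which $x$ is represented by a diagonal matrix $D=\mathrm{diag}(\alpha,\alpha-1,\dots,\alpha-(m-1))$ for some $\alpha\in F$ and every $u\in\mathfrak{a}(i)$, $0\le i<m$, is represented by $f^i(u)J^i$, where $J=J_m(0)$.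
   Context: A $\mathfrak{g}$-module is admissible if every element of $[\mathfrak{g},\mathfrak{g}]$ acts on it via a nilpotent operator. A module is uniserial if it has a unique composition series. For $\delta\in F$, $\mathfrak{a}(\delta)=\{v\in\mathfrak{a}\,|\,[x,v]=\delta v\}$ (possibly zero), computed with respect to the rescaled $x$ after the rescaling; integers are viewed as elements of $F$ through the canonical map $\mathbb{Z}\to F$. $J_m(0)$ is the $m\times m$ upper triangular Jordan block with eigenvalue $0$, and $J^0=I$.
   Formalization: In (4), the fixed non-zero v in a(1) is also required not to annihilate U (v not in b(1)); without this (4) is false, since f^1(v)=1 forces v to act as J, which is non-zero. *)

theory Defs
  imports "Jordan_Normal_Form.Jordan_Normal_Form"
begin

definition fin_dim :: "('f::field \<Rightarrow> 'v::ab_group_add \<Rightarrow> 'v) \<Rightarrow> bool" where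
  "fin_dim s \<longleftrightarrow> (\<exists>B. finite_dimensional_vector_space s B)"

context vector_space
begin

definition hyperplane_of :: "'b set \<Rightarrow> 'b set \<Rightarrow> bool" where
  "hyperplane_of H W \<longleftrightarrow> subspace H \<and> subspace W \<and> H \<subseteq> W \<and> dim W = dim H + 1"

definition functional_on :: "'b set \<Rightarrow> ('b \<Rightarrow> 'a) \<Rightarrow> bool" where
  "functional_on W f \<longleftrightarrow>
     (\<forall>u\<in>W. \<forall>w\<in>W. f (u + w) = f u + f w) \<and> (\<forall>c. \<forall>u\<in>W. f (scale c u) = c * f u)"

definition ordered_basis :: "'b list \<Rightarrow> bool" where
  "ordered_basis es \<longleftrightarrow> distinct es \<and> independent (set es) \<and> span (set es) = UNIV"

text \<open>Column convention: column \<open>j\<close> of \<open>M\<close> holds the coordinates of the image of the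
  \<open>j\<close>-th basis vector.\<close>

definition represented_by :: "'b list \<Rightarrow> ('b \<Rightarrow> 'b) \<Rightarrow> 'a mat \<Rightarrow> bool" where
  "represented_by es T M \<longleftrightarrow>
     M \<in> carrier_mat (length es) (length es) \<and>
     (\<forall>j<length es. T (es ! j) = (\<Sum>i<length es. scale (M $$ (i, j)) (es ! i)))"

end

locale lie_algebra = vector_space scale
  for scale :: "'f::field \<Rightarrow> 'g::ab_group_add \<Rightarrow> 'g" +
  fixes br :: "'g \<Rightarrow> 'g \<Rightarrow> 'g"
  assumes br_linear_right: "Vector_Spaces.linear scale scale (br y)"
    and br_linear_left: "Vector_Spaces.linear scale scale (\<lambda>y. br y z)"
    and br_self: "br y y = 0"
    and jacobi: "br y (br z w) + br z (br w y) + br w (br y z) = 0"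
begin

definition derived_algebra :: "'g set" where
  "derived_algebra = span {br y z | y z. True}"

definition abelian_ideal :: "'g set \<Rightarrow> bool" where
  "abelian_ideal A \<longleftrightarrow>
     subspace A \<and> (\<forall>y. \<forall>u\<in>A. br y u \<in> A) \<and> (\<forall>u\<in>A. \<forall>w\<in>A. br u w = 0)"

text \<open>The whole algebra is the internal semidirect product of the line spanned by \<open>x\<close>
  with the abelian ideal \<open>A\<close>.\<close>

definition line_semidirect :: "'g \<Rightarrow> 'g set \<Rightarrow> bool" where
  "line_semidirect x A \<longleftrightarrow>
     abelian_ideal A \<and> span {x} \<inter> A = {0} \<and> (\<forall>y. \<exists>c. \<exists>u\<in>A. y = scale c x + u)"

definition ad_diagonalizable_on :: "'g \<Rightarrow> 'g set \<Rightarrow> bool" where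
  "ad_diagonalizable_on x A \<longleftrightarrow>
     (\<exists>B. independent B \<and> span B = A \<and> (\<forall>b\<in>B. \<exists>\<delta>. br x b = scale \<delta> b))"

definition ad_eigenspace :: "'g set \<Rightarrow> 'g \<Rightarrow> 'f \<Rightarrow> 'g set" where
  "ad_eigenspace A x \<delta> = {v \<in> A. br x v = scale \<delta> v}"

definition ad_eigenvalue :: "'g set \<Rightarrow> 'g \<Rightarrow> 'f \<Rightarrow> bool" where
  "ad_eigenvalue A x \<delta> \<longleftrightarrow> (\<exists>v\<in>ad_eigenspace A x \<delta>. v \<noteq> 0)"

end

locale lie_module = L: lie_algebra scale br + V: vector_space scaleU
  for scale :: "'f::field \<Rightarrow> 'g::ab_group_add \<Rightarrow> 'g"
    and br :: "'g \<Rightarrow> 'g \<Rightarrow> 'g"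
    and scaleU :: "'f \<Rightarrow> 'u::ab_group_add \<Rightarrow> 'u" +
  fixes act :: "'g \<Rightarrow> 'u \<Rightarrow> 'u"
  assumes act_linear_right: "Vector_Spaces.linear scaleU scaleU (act y)"
    and act_linear_left: "Vector_Spaces.linear scale scaleU (\<lambda>y. act y w)"
    and act_br: "act (br y z) w = act y (act z w) - act z (act y w)"
begin

definition acts_trivially :: "'g set \<Rightarrow> bool" where
  "acts_trivially Y \<longleftrightarrow> (\<forall>y\<in>Y. \<forall>w. act y w = 0)"

definition faithful :: bool where
  "faithful \<longleftrightarrow> (\<forall>y. (\<forall>w. act y w = 0) \<longrightarrow> y = 0)"

definition admissible :: bool where
  "admissible \<longleftrightarrow> (\<forall>y\<in>L.derived_algebra. \<exists>n. \<forall>w. (act y ^^ n) w = 0)"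

definition submodule :: "'u set \<Rightarrow> bool" where
  "submodule W \<longleftrightarrow> V.subspace W \<and> (\<forall>y. \<forall>w\<in>W. act y w \<in> W)"

text \<open>Simplicity of the factors is expressed by the absence of submodules strictly between
  consecutive terms.\<close>

definition composition_series :: "'u set list \<Rightarrow> bool" where
  "composition_series Ws \<longleftrightarrow>
     Ws \<noteq> [] \<and> hd Ws = {0} \<and> last Ws = UNIV \<and> (\<forall>W\<in>set Ws. submodule W) \<and>
     (\<forall>i. Suc i < length Ws \<longrightarrow> Ws ! i \<subset> Ws ! Suc i \<and>
        \<not> (\<exists>W. submodule W \<and> Ws ! i \<subset> W \<and> W \<subset> Ws ! Suc i))"

definition uniserial :: bool where
  "uniserial \<longleftrightarrow> (\<exists>!Ws. composition_series Ws)"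

text \<open>The length counts the factors, one less than the number of terms.\<close>

definition has_composition_length :: "nat \<Rightarrow> bool" where
  "has_composition_length m \<longleftrightarrow> (\<exists>Ws. composition_series Ws \<and> length Ws = Suc m)"

definition active_eigenvalues :: "'g set \<Rightarrow> 'g \<Rightarrow> 'f set" where
  "active_eigenvalues A x =
     {\<delta>. L.ad_eigenvalue A x \<delta> \<and> \<not> acts_trivially (L.ad_eigenspace A x \<delta>)}"

definition eigenspace_annihilator :: "'g set \<Rightarrow> 'g \<Rightarrow> 'f \<Rightarrow> 'g set" where
  "eigenspace_annihilator A x \<delta> = {v \<in> L.ad_eigenspace A x \<delta>. \<forall>w. act v w = 0}"

end

end

theory Submission
  imports Defs
begin

text \<open>
  Write \<open>X\<close> for the action of \<open>x\<close>, call \<open>u\<close> in \<open>A\<close> a weight vector of weight \<open>\<delta>\<close> if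
  \<open>[x, u] = \<delta> u\<close>, and let \<open>0 = U 0 < ... < U m\<close> be the composition series. Since \<open>A\<close> is abelian and
  spanned by weight vectors, a subspace is a submodule as soon as it is stable under \<open>X\<close> and the
  weight vectors, and any two weight vectors commute.

  On a simple factor every weight vector acts as a scalar, because the vectors on which it acts by
  that scalar form a submodule; admissibility makes the scalar \<open>0\<close> for non-zero weights. Hence an
  eigenvector of \<open>X\<close> spans the factor (\<open>minimal_extension\<close>), so factors are one-dimensional,
  \<open>m = dim U\<close>, and \<open>X\<close> has an eigenvalue \<open>eigval i\<close> on \<open>U (i + 1) / U i\<close>.

  Uniseriality enters through an exchange argument (\<open>between_unique\<close>): a submodule strictly between
  \<open>U i\<close> and \<open>U (i + 2)\<close> could replace \<open>U (i + 1)\<close> in the composition series, so it equals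
  \<open>U (i + 1)\<close>. Therefore any two consecutive factors are linked: either \<open>X\<close> or some weight vector,
  say of weight \<open>\<delta>\<close>, carries a generalized eigenvector of the upper factor to a vector that is
  non-zero in the lower one (\<open>factor_link\<close>), and then \<open>eigval i = eigval (i + 1) + \<delta>\<close>, with \<open>\<delta> = 0\<close> when the
  link is \<open>X\<close> itself. The linking operators commute up to an index shift, and applying two
  consecutive links in the opposite order forces their weights to agree (\<open>eigval_step\<close>): otherwise
  the intermediate vector would have a generalized eigenvalue that the middle factor does not have.
  So the eigenvalues of \<open>X\<close> form an arithmetic progression. Its step is not \<open>0\<close>, for with a single
  eigenvalue no weight vector of non-zero weight could act non-trivially; by the assumption on
  the characteristic its members are then distinct. Consequently \<open>X\<close> is diagonalizable with
  one-dimensional eigenspaces, and \<open>x\<close> can be rescaled so that the step becomes \<open>1\<close>.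

  A weight vector moves eigenlines to eigenlines and never up in the flag, which bounds the weights
  that act non-trivially (\<open>active_weight\<close>). If \<open>v\<close> has weight equal to the step and acts
  non-trivially somewhere, commuting it with the links shows that it is non-zero on every
  eigenline but the lowest (\<open>raising_nonzero\<close>). So the images of a top eigenvector under the powers
  of \<open>v\<close> form an eigenbasis in which \<open>v\<close> is a Jordan block. Finally a weight vector \<open>u\<close> of
  weight \<open>i\<close> times the step agrees with a multiple of \<open>v ^ i\<close> on the top eigenvector for
  weight reasons, and hence everywhere, as both commute with \<open>v\<close> (\<open>act_raising_basis\<close>).
  The multiple depends linearly on \<open>u\<close> and vanishes exactly on the annihilator of the module;
  this gives the functionals and the hyperplanes.
\<close>

section \<open>Eigenvectors modulo an invariant subspace\<close>

text \<open>The value \<open>p(T) w\<close>, written as a Horner scheme so that induction over \<open>pCons\<close> applies.\<close>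

definition poly_apply :: "('f::field \<Rightarrow> 'u::ab_group_add \<Rightarrow> 'u) \<Rightarrow> ('u \<Rightarrow> 'u) \<Rightarrow> 'f poly \<Rightarrow> 'u \<Rightarrow> 'u" where
  "poly_apply s T p w = fold_coeffs (\<lambda>a r. s a w + T r) p 0"

context
  fixes s :: "'f::field \<Rightarrow> 'u::ab_group_add \<Rightarrow> 'u" and T :: "'u \<Rightarrow> 'u"
  assumes lin: "Vector_Spaces.linear s s T"
begin

interpretation T: Vector_Spaces.linear s s T by (fact lin)

lemma poly_apply_0 [simp]: "poly_apply s T 0 w = 0"
  by (simp add: poly_apply_def)

lemma poly_apply_pCons: "poly_apply s T (pCons a p) w = s a w + T (poly_apply s T p w)"
  by (cases "a = 0"; cases "p = 0") (simp_all add: poly_apply_def T.zero T.vs1.scale_zero_left)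

lemma poly_apply_add: "poly_apply s T (p + q) w = poly_apply s T p w + poly_apply s T q w"
  by (induction p q rule: poly_induct2)
     (simp_all add: poly_apply_pCons T.add T.vs1.scale_left_distrib algebra_simps)

lemma poly_apply_smult: "poly_apply s T (Polynomial.smult c p) w = s c (poly_apply s T p w)"
  by (induction p) (simp_all add: poly_apply_pCons T.scale T.vs1.scale_right_distrib)

lemma poly_apply_linear_factor:
  "poly_apply s T ([:- c, 1:] * q) w = T (poly_apply s T q w) - s c (poly_apply s T q w)"
proof -
  have "[:- c, 1:] * q = Polynomial.smult (- c) q + pCons 0 q" by simp
  then show ?thesis
    by (simp only: poly_apply_add poly_apply_pCons poly_apply_smult) (simp add: T.vs1.scale_minus_left)
qed

lemma poly_apply_monom: "poly_apply s T (monom a n) w = s a ((T ^^ n) w)"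
  by (induction n) (simp_all add: poly_apply_pCons monom_0 monom_Suc T.scale)

lemma poly_apply_sum: "poly_apply s T (\<Sum>i\<in>I. p i) w = (\<Sum>i\<in>I. poly_apply s T (p i) w)"
  by (induction I rule: infinite_finite_induct) (simp_all add: poly_apply_add)

lemma poly_apply_mem:
  assumes "module.subspace s W" "\<And>w. w \<in> W \<Longrightarrow> T w \<in> W" "w \<in> W"
  shows "poly_apply s T p w \<in> W"
  by (induction p)
    (auto simp: poly_apply_pCons assms T.vs1.subspace_0 T.vs1.subspace_add T.vs1.subspace_scale)

text \<open>The iterates \<open>w, T w, T^2 w, ...\<close> up to the dimension are either not distinct or linearly
  dependent; both give a polynomial relation.\<close>

lemma annihilating_poly_exists:
  assumes "finite_dimensional_vector_space s BU"
  shows "\<exists>p. p \<noteq> 0 \<and> poly_apply s T p w = 0"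
proof -
  interpret F: finite_dimensional_vector_space s BU by fact
  let ?g = "\<lambda>i. (T ^^ i) w"
  let ?n = "card BU"
  show ?thesis
  proof (cases "inj_on ?g {..?n}")
    case False
    then obtain i j where ij: "i \<noteq> j" "?g i = ?g j"
      by (auto simp: inj_on_def)
    have "coeff (monom 1 i + monom (- 1) j :: 'f poly) i \<noteq> 0"
      using ij(1) by simp
    then have "monom 1 i + monom (- 1) j \<noteq> (0 :: 'f poly)"
      by (metis coeff_0)
    moreover have "poly_apply s T (monom 1 i + monom (- 1) j) w = 0"
      using ij(2) by (simp add: poly_apply_add poly_apply_monom)
    ultimately show ?thesis by blast
  next
    case True
    have "module.dependent s (?g ` {..?n})"
      using F.independent_card_le_dim[of "?g ` {..?n}" UNIV] by (auto simp: card_image[OF True])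
    then obtain u v where u: "v \<in> ?g ` {..?n}" "u v \<noteq> 0"
        and sum0: "(\<Sum>v\<in>?g ` {..?n}. s (u v) v) = 0"
      by (subst (asm) T.vs1.dependent_finite) auto
    define p where "p = (\<Sum>i\<le>?n. monom (u (?g i)) i)"
    have "poly_apply s T p w = (\<Sum>i\<le>?n. s (u (?g i)) (?g i))"
      by (simp add: p_def poly_apply_sum poly_apply_monom)
    also have "\<dots> = 0"
      using sum0 by (simp add: sum.reindex[OF True])
    finally have "poly_apply s T p w = 0" .
    moreover obtain k where "k \<le> ?n" "v = ?g k"
      using u(1) by auto
    then have "coeff p k \<noteq> 0"
      using u(2) by (simp add: p_def coeff_sum)
    ultimately show ?thesis by (metis coeff_0)
  qed
qed

end

text \<open>For a non-zero polynomial \<open>p\<close> of least degree with \<open>p(T) w \<in> W\<close>, split off a linear factor,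
  \<open>p = (t - c) q\<close>: then \<open>q(T) w\<close> is not in \<open>W\<close> and is an eigenvector modulo \<open>W\<close>. This avoids
  quotient spaces.\<close>

lemma eigenvector_mod_subspace:
  fixes s :: "'f::alg_closed_field \<Rightarrow> 'u::ab_group_add \<Rightarrow> 'u"
  assumes fd: "finite_dimensional_vector_space s BU"
    and lin: "Vector_Spaces.linear s s T"
    and W: "module.subspace s W"
    and W': "module.subspace s W'" "\<And>w. w \<in> W' \<Longrightarrow> T w \<in> W'"
    and ex: "\<exists>w\<in>W'. w \<notin> W"
  shows "\<exists>c. \<exists>e\<in>W'. e \<notin> W \<and> T e - s c e \<in> W"
proof -
  interpret F: finite_dimensional_vector_space s BU by fact
  obtain w where w: "w \<in> W'" "w \<notin> W" using ex by blast
  define P where "P = (\<lambda>p. p \<noteq> 0 \<and> poly_apply s T p w \<in> W)"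
  have "\<exists>p. P p"
    using annihilating_poly_exists[OF lin fd, of w] F.subspace_0[OF W] by (auto simp: P_def)
  then obtain p where p: "P p" and min: "\<And>q. P q \<Longrightarrow> degree p \<le> degree q"
    using ex_has_least_nat[of P _ degree] by blast
  have "degree p > 0"
  proof (rule ccontr)
    assume "\<not> degree p > 0"
    then obtain a where "p = [:a:]" by (metis degree_eq_zeroE gr0I)
    then have "a \<noteq> 0" "s a w \<in> W"
      using p module_hom.zero[OF Vector_Spaces.linear.axioms(3)[OF lin]]
      by (auto simp: P_def poly_apply_pCons[OF lin] poly_apply_0[OF lin])
    then have "s (inverse a * a) w \<in> W"
      using F.subspace_scale[OF W, of "s a w" "inverse a"] by simp
    then show False using \<open>a \<noteq> 0\<close> w(2) by simp
  qed
  then obtain c where "poly p c = 0" using alg_closed_imp_poly_has_root by blast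
  then obtain q where q: "p = [:- c, 1:] * q" by (auto simp: poly_eq_0_iff_dvd elim: dvdE)
  have "q \<noteq> 0" using p q by (auto simp: P_def)
  then have "degree q < degree p" unfolding q by (subst degree_mult_eq) auto
  then have "poly_apply s T q w \<notin> W" using min[of q] \<open>q \<noteq> 0\<close> by (auto simp: P_def)
  moreover have "poly_apply s T q w \<in> W'"
    by (rule poly_apply_mem[OF lin W'(1)]) (use W' w in auto)
  moreover have "T (poly_apply s T q w) - s c (poly_apply s T q w) \<in> W"
    using p by (simp only: P_def q poly_apply_linear_factor[OF lin])
  ultimately show ?thesis by blast
qed

section \<open>Linear functionals and iterated maps\<close>

lemma (in finite_dimensional_vector_space) kernel_hyperplane:
  assumes W: "subspace W" and f: "functional_on W f" and w0: "w0 \<in> W" "f w0 \<noteq> 0"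
  shows "hyperplane_of {w \<in> W. f w = 0} W"
proof -
  let ?H = "{w \<in> W. f w = 0}"
  have add: "f (u + w) = f u + f w" if "u \<in> W" "w \<in> W" for u w
    using f that by (simp add: functional_on_def)
  have scale: "f (scale c u) = c * f u" if "u \<in> W" for c u
    using f that by (simp add: functional_on_def)
  have H: "subspace ?H"
  proof (rule subspaceI)
    show "0 \<in> ?H" using scale[OF w0(1), of 0] W by (simp add: subspace_0)
  qed (use W add scale in \<open>auto simp: subspace_add subspace_scale\<close>)
  have spH: "span ?H = ?H" using H by (simp add: span_eq_iff)
  have "W = span (insert w0 ?H)"
  proof
    show "W \<subseteq> span (insert w0 ?H)"
    proof
      fix w assume w: "w \<in> W"
      let ?k = "f w / f w0"
      have "w - scale ?k w0 = w + scale (- ?k) w0" by simp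
      moreover have "f (w + scale (- ?k) w0) = 0"
        using w w0 W by (simp only: add scale subspace_scale) simp
      ultimately have "w - scale ?k w0 \<in> ?H"
        using w w0 W by (simp add: subspace_diff subspace_scale)
      then show "w \<in> span (insert w0 ?H)" by (auto simp: span_insert spH)
    qed
    show "span (insert w0 ?H) \<subseteq> W" using w0 W by (intro span_minimal) auto
  qed
  then have "dim W = dim (insert w0 ?H)" by (metis dim_span)
  also have "\<dots> = dim ?H + 1" using w0 by (simp add: dim_insert spH)
  finally show ?thesis using H W by (auto simp: hyperplane_of_def)
qed

lemma module_hom_funpow:
  assumes f: "module_hom s s f"
  shows "module_hom s s (f ^^ n)"
proof -
  interpret f: module_hom s s f by (fact f)
  show ?thesis
    by (induction n; unfold_locales) (simp_all add: f.add f.scale module_hom.add module_hom.scale)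
qed

section \<open>Weight vectors acting on a module\<close>

locale split_module = lie_module sg br sU act + V: finite_dimensional_vector_space sU BU
  for sg :: "'f::alg_closed_field \<Rightarrow> 'g::ab_group_add \<Rightarrow> 'g"
    and br :: "'g \<Rightarrow> 'g \<Rightarrow> 'g"
    and sU :: "'f \<Rightarrow> 'u::ab_group_add \<Rightarrow> 'u"
    and act :: "'g \<Rightarrow> 'u \<Rightarrow> 'u"
    and BU :: "'u set" +
  fixes x :: 'g and A :: "'g set"
  assumes semidirect: "L.line_semidirect x A"
    and diagonalizable: "L.ad_diagonalizable_on x A"
    and admissible: "admissible"
begin

abbreviation E :: "'f \<Rightarrow> 'g set" where
  "E \<equiv> L.ad_eigenspace A x"

abbreviation X :: "'u \<Rightarrow> 'u" where
  "X \<equiv> act x"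

lemma act_hom: "module_hom sU sU (act y)"
  using act_linear_right by (rule Vector_Spaces.linear.axioms(3))

lemma act_hom_left: "module_hom sg sU (\<lambda>y. act y w)"
  using act_linear_left by (rule Vector_Spaces.linear.axioms(3))

lemmas act_add = module_hom.add[OF act_hom]
  and act_diff = module_hom.diff[OF act_hom]
  and act_scale = module_hom.scale[OF act_hom]
  and act_zero [simp] = module_hom.zero[OF act_hom]
  and act_add_left = module_hom.add[OF act_hom_left]
  and act_scale_left = module_hom.scale[OF act_hom_left]
  and act_zero_left [simp] = module_hom.zero[OF act_hom_left]

lemmas lin_simps = act_add act_diff act_scale V.scale_right_distrib V.scale_left_distrib
  V.scale_right_diff_distrib V.scale_left_diff_distrib

lemma subspace_A: "L.subspace A"
  using semidirect by (simp add: L.line_semidirect_def L.abelian_ideal_def)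

lemma eigenspace_subset: "E \<delta> \<subseteq> A"
  by (auto simp: L.ad_eigenspace_def)

lemma subspace_eigenspace: "L.subspace (E \<delta>)"
proof -
  interpret b: module_hom sg sg "br x"
    using L.br_linear_right by (rule Vector_Spaces.linear.axioms(3))
  show ?thesis
    unfolding L.subspace_def L.ad_eigenspace_def using subspace_A
    by (auto simp: b.add b.scale b.zero L.scale_right_distrib mult.commute
        L.subspace_0 L.subspace_add L.subspace_scale)
qed

lemma act_commute:
  assumes "u \<in> A" "v \<in> A"
  shows "act u (act v w) = act v (act u w)"
proof -
  have "br u v = 0"
    using semidirect assms by (simp add: L.line_semidirect_def L.abelian_ideal_def)
  then show ?thesis using act_br[of u v w] by simp
qed

lemma weight_commute: "u \<in> E \<delta> \<Longrightarrow> v \<in> E \<epsilon> \<Longrightarrow> act u (act v w) = act v (act u w)"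
  using act_commute eigenspace_subset by blast

lemma act_weight:
  assumes "u \<in> E \<delta>"
  shows "X (act u w) = act u (X w) + sU \<delta> (act u w)"
proof -
  have "br x u = sg \<delta> u" using assms by (simp add: L.ad_eigenspace_def)
  then show ?thesis using act_br[of x u w] by (simp add: act_scale_left algebra_simps)
qed

text \<open>The only use of diagonalizability: it suffices to study weight vectors.\<close>

lemma span_eigenspaces: "A \<subseteq> L.span (\<Union>\<delta>. E \<delta>)"
proof -
  obtain B where B: "L.span B = A" "\<forall>b\<in>B. \<exists>\<delta>. br x b = sg \<delta> b"
    using diagonalizable by (auto simp: L.ad_diagonalizable_on_def)
  have "B \<subseteq> (\<Union>\<delta>. E \<delta>)"
    using B L.span_base[of _ B] by (auto simp: L.ad_eigenspace_def)
  then show ?thesis using L.span_mono B(1) by blast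
qed

lemma semidirect_decompose:
  obtains c u where "u \<in> A" "y = sg c x + u"
  using semidirect unfolding L.line_semidirect_def by blast

lemma act_mem_of_eigenspaces:
  assumes W: "V.subspace W"
    and E: "\<And>\<delta> u. u \<in> E \<delta> \<Longrightarrow> act u w \<in> W"
    and u: "u \<in> A"
  shows "act u w \<in> W"
proof -
  have "u \<in> L.span (\<Union>\<delta>. E \<delta>)" using span_eigenspaces u by blast
  then show ?thesis
    by (induction rule: L.span_induct_alt)
       (auto simp: act_add_left act_scale_left intro!: V.subspace_add V.subspace_scale W E
         V.subspace_0[OF W])
qed

lemma submoduleI:
  assumes W: "V.subspace W"
    and X: "\<And>w. w \<in> W \<Longrightarrow> X w \<in> W"
    and E: "\<And>\<delta> u w. u \<in> E \<delta> \<Longrightarrow> w \<in> W \<Longrightarrow> act u w \<in> W"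
  shows "submodule W"
  unfolding submodule_def
proof (intro conjI allI ballI W)
  fix y w assume w: "w \<in> W"
  obtain c u where u: "u \<in> A" "y = sg c x + u" by (rule semidirect_decompose)
  have "act u w \<in> W" by (rule act_mem_of_eigenspaces[OF W E[OF _ w] u(1)])
  then show "act y w \<in> W"
    by (simp add: u(2) act_add_left act_scale_left X w V.subspace_add V.subspace_scale W)
qed

text \<open>For \<open>\<delta> \<noteq> 0\<close> the vector \<open>u = [x, u] / \<delta>\<close> lies in the derived algebra.\<close>

lemma weight_nilpotent:
  assumes "u \<in> E \<delta>" "\<delta> \<noteq> 0"
  shows "\<exists>n. \<forall>w. (act u ^^ n) w = 0"
proof -
  have "br x u = sg \<delta> u" using assms(1) by (simp add: L.ad_eigenspace_def)
  then have "u = sg (inverse \<delta>) (br x u)" using assms(2) by simp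
  then have "u \<in> L.derived_algebra"
    unfolding L.derived_algebra_def by (metis (mono_tags, lifting) L.span_base L.span_scale mem_Collect_eq)
  then show ?thesis using admissible by (simp add: admissible_def)
qed

text \<open>If all weight vectors of non-zero weight acted trivially, then \<open>X\<close> would commute with the action
  of \<open>A\<close>, and every bracket would act as zero.\<close>

lemma nonzero_weight_acts:
  assumes "\<not> acts_trivially L.derived_algebra"
  shows "\<exists>\<delta> u w. \<delta> \<noteq> 0 \<and> u \<in> E \<delta> \<and> act u w \<noteq> 0"
proof (rule ccontr)
  assume neg: "\<not> ?thesis"
  have comm: "act u (X w) = X (act u w)" if "u \<in> A" for u w
  proof -
    have "u \<in> L.span (\<Union>\<delta>. E \<delta>)" using span_eigenspaces that by blast
    then show ?thesis
    proof (induction rule: L.span_induct_alt)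
      case base then show ?case by simp
    next
      case (step c u y)
      then obtain \<delta> where \<delta>: "u \<in> E \<delta>" by blast
      have "sU \<delta> (act u w) = 0" using neg \<delta> by (cases "\<delta> = 0") auto
      then have "X (act u w) = act u (X w)" using act_weight[OF \<delta>, of w] by simp
      then show ?case using step by (simp add: act_add_left act_scale_left lin_simps)
    qed
  qed
  have br0: "act (br y z) w = 0" for y z w
  proof -
    obtain c u where u: "u \<in> A" "y = sg c x + u" by (rule semidirect_decompose)
    obtain d v where v: "v \<in> A" "z = sg d x + v" by (rule semidirect_decompose)
    show ?thesis
      unfolding act_br u(2) v(2)
      by (simp add: act_add_left act_scale_left lin_simps comm[OF u(1)] comm[OF v(1)]
          act_commute[OF u(1) v(1)] algebra_simps)
  qed
  have "act y w = 0" if "y \<in> L.derived_algebra" for y w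
    using that unfolding L.derived_algebra_def
    by (induction rule: L.span_induct_alt) (auto simp: act_add_left act_scale_left br0)
  then show False using assms by (simp add: acts_trivially_def)
qed

section \<open>Simple factors are one-dimensional\<close>

text \<open>For a subspace \<open>W\<close> this is the span of \<open>W\<close> and \<open>e\<close>, in a form that displays membership modulo \<open>W\<close>.\<close>

definition line_extension :: "'u set \<Rightarrow> 'u \<Rightarrow> 'u set" where
  "line_extension W e = {w. \<exists>c. w - sU c e \<in> W}"

lemma subspace_line_extension:
  assumes "V.subspace W" shows "V.subspace (line_extension W e)"
proof -
  have "line_extension W e = V.span (insert e W)"
    using assms by (simp add: line_extension_def V.span_insert V.span_eq_iff[THEN iffD2])
  then show ?thesis by simp
qed

text \<open>Weight vectors commute with \<open>u\<close>, and \<open>X\<close> changes \<open>u w\<close> only by a multiple of itself. The latter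
  is compatible with the shift by \<open>\<mu>\<close> since \<open>\<mu>\<close> or \<open>\<delta>\<close> is zero.\<close>

lemma submodule_weight_kernel:
  assumes W: "submodule W" and W': "submodule W'" and u: "u \<in> E \<delta>" and \<mu>: "\<delta> \<noteq> 0 \<Longrightarrow> \<mu> = 0"
  shows "submodule {w \<in> W'. act u w - sU \<mu> w \<in> W}"
proof (rule submoduleI)
  have sW: "V.subspace W" and sW': "V.subspace W'"
    and aW: "\<And>y w. w \<in> W \<Longrightarrow> act y w \<in> W" and aW': "\<And>y w. w \<in> W' \<Longrightarrow> act y w \<in> W'"
    using W W' by (auto simp: submodule_def)
  let ?K = "{w \<in> W'. act u w - sU \<mu> w \<in> W}"
  show "V.subspace ?K"
  proof (rule V.subspaceI)
    show "0 \<in> ?K" by (simp add: V.subspace_0 sW sW')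
  next
    fix a b assume ab: "a \<in> ?K" "b \<in> ?K"
    have "act u (a + b) - sU \<mu> (a + b) = (act u a - sU \<mu> a) + (act u b - sU \<mu> b)"
      by (simp add: lin_simps algebra_simps)
    then show "a + b \<in> ?K" using ab by (auto intro: V.subspace_add sW sW')
  next
    fix c a assume a: "a \<in> ?K"
    have "act u (sU c a) - sU \<mu> (sU c a) = sU c (act u a - sU \<mu> a)"
      by (simp add: lin_simps mult.commute)
    then show "sU c a \<in> ?K" using a by (auto intro: V.subspace_scale sW sW')
  qed
  show "X w \<in> ?K" if "w \<in> ?K" for w
  proof -
    have \<delta>\<mu>: "sU \<delta> (sU \<mu> w) = 0" using \<mu> by (cases "\<delta> = 0") auto
    have "act u (X w) - sU \<mu> (X w) = X (act u w - sU \<mu> w) - sU \<delta> (act u w - sU \<mu> w)"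
      by (simp add: lin_simps act_weight[OF u] \<delta>\<mu>[simplified])
    then show ?thesis using that aW aW' by (auto intro!: V.subspace_diff V.subspace_scale sW)
  qed
  show "act v w \<in> ?K" if "v \<in> E \<epsilon>" "w \<in> ?K" for v \<epsilon> w
  proof -
    have "act u (act v w) = act v (act u w)"
      using act_commute u that(1) eigenspace_subset by blast
    then have "act u (act v w) - sU \<mu> (act v w) = act v (act u w - sU \<mu> w)"
      by (simp add: lin_simps)
    then show ?thesis using that aW aW' by auto
  qed
qed

lemma submodule_line_extension:
  assumes W: "submodule W" and c: "X e - sU c e \<in> W"
    and scalar: "\<And>\<delta> u. u \<in> E \<delta> \<Longrightarrow> \<exists>\<mu>. act u e - sU \<mu> e \<in> W"
  shows "submodule (line_extension W e)"
proof (rule submoduleI)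
  have sW: "V.subspace W" and aW: "\<And>y w. w \<in> W \<Longrightarrow> act y w \<in> W"
    using W by (auto simp: submodule_def)
  have act: "act y w \<in> line_extension W e" if "w \<in> line_extension W e" and \<mu>: "act y e - sU \<mu> e \<in> W" for y w \<mu>
  proof -
    obtain d where d: "w - sU d e \<in> W" using \<open>w \<in> line_extension W e\<close> by (auto simp: line_extension_def)
    have "act y w - sU (d * \<mu>) e = act y (w - sU d e) + sU d (act y e - sU \<mu> e)"
      by (simp add: lin_simps)
    then have "act y w - sU (d * \<mu>) e \<in> W"
      using d \<mu> aW by (auto intro!: V.subspace_add V.subspace_scale sW)
    then show ?thesis by (auto simp: line_extension_def)
  qed
  show "V.subspace (line_extension W e)" by (rule subspace_line_extension[OF sW])
  show "X w \<in> line_extension W e" if "w \<in> line_extension W e" for w by (rule act[OF that c])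
  show "act u w \<in> line_extension W e" if "u \<in> E \<delta>" "w \<in> line_extension W e" for u \<delta> w
    using scalar[OF that(1)] act[OF that(2)] by blast
qed

lemma subset_line_extension:
  assumes "V.subspace W"
  shows "W \<subseteq> line_extension W e" "e \<in> line_extension W e"
  using V.subspace_0[OF assms] by (auto simp: line_extension_def intro: exI[of _ 0] exI[of _ 1])

text \<open>The internal form of "a simple admissible module is one-dimensional". A weight vector has an
  eigenvector modulo \<open>W\<close> (nilpotency provides one with eigenvalue \<open>0\<close> if the weight is not \<open>0\<close>), so
  the submodule of \<open>submodule_weight_kernel\<close> is bigger than \<open>W\<close> and thus all of \<open>W'\<close>. Once
  all weight vectors act as scalars modulo \<open>W\<close>, any eigenvector of \<open>X\<close> modulo \<open>W\<close> generates \<open>W'\<close>.\<close>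

lemma minimal_extension:
  assumes W: "submodule W" and W': "submodule W'" and sub: "W \<subset> W'"
    and cover: "\<not> (\<exists>Z. submodule Z \<and> W \<subset> Z \<and> Z \<subset> W')"
  shows "\<exists>e c. e \<in> W' \<and> e \<notin> W \<and> W' = line_extension W e \<and> X e - sU c e \<in> W"
    and "u \<in> E \<delta> \<Longrightarrow> \<exists>\<mu>. (\<delta> \<noteq> 0 \<longrightarrow> \<mu> = 0) \<and> (\<forall>w\<in>W'. act u w - sU \<mu> w \<in> W)"
proof -
  have sW: "V.subspace W" and sW': "V.subspace W'"
    and aW: "\<And>y w. w \<in> W \<Longrightarrow> act y w \<in> W" and aW': "\<And>y w. w \<in> W' \<Longrightarrow> act y w \<in> W'"
    using W W' by (auto simp: submodule_def)
  have scalar: "\<exists>\<mu>. (\<delta> \<noteq> 0 \<longrightarrow> \<mu> = 0) \<and> (\<forall>w\<in>W'. act u w - sU \<mu> w \<in> W)" if u: "u \<in> E \<delta>" for u \<delta>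
  proof -
    obtain \<mu> e where \<mu>: "\<delta> \<noteq> 0 \<longrightarrow> \<mu> = 0" and e: "e \<in> W'" "e \<notin> W" "act u e - sU \<mu> e \<in> W"
    proof (cases "\<delta> = 0")
      case True
      then show ?thesis
        using that eigenvector_mod_subspace[OF V.finite_dimensional_vector_space_axioms
            act_linear_right sW sW' aW', of u] sub by blast
    next
      case False
      obtain n where n: "\<And>w. (act u ^^ n) w = 0" using weight_nilpotent[OF u False] by blast
      obtain w where w: "w \<in> W'" "w \<notin> W" using sub by blast
      have "\<exists>k. (act u ^^ k) w \<notin> W \<and> (act u ^^ Suc k) w \<in> W"
      proof (rule ccontr)
        assume neg: "\<not> ?thesis"
        have "(act u ^^ k) w \<notin> W" for k
          using w neg by (induction k) auto
        then show False using n[of w] V.subspace_0[OF sW] by metis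
      qed
      then obtain k where k: "(act u ^^ k) w \<notin> W" "act u ((act u ^^ k) w) \<in> W" by auto
      have "(act u ^^ k) w \<in> W'" using w aW' by (induction k) auto
      then show ?thesis using that[of 0 "(act u ^^ k) w"] k by simp
    qed
    let ?K = "{w \<in> W'. act u w - sU \<mu> w \<in> W}"
    have "submodule ?K" using submodule_weight_kernel[OF W W' u] \<mu> by blast
    moreover have "W \<subset> ?K"
      using e sub aW by (auto intro!: V.subspace_diff V.subspace_scale sW)
    ultimately have "?K = W'" using cover by blast
    then show ?thesis using \<mu> by blast
  qed
  then show "u \<in> E \<delta> \<Longrightarrow> \<exists>\<mu>. (\<delta> \<noteq> 0 \<longrightarrow> \<mu> = 0) \<and> (\<forall>w\<in>W'. act u w - sU \<mu> w \<in> W)"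
    by blast
  obtain c e where e: "e \<in> W'" "e \<notin> W" "X e - sU c e \<in> W"
    using eigenvector_mod_subspace[OF V.finite_dimensional_vector_space_axioms
            act_linear_right sW sW' aW', of x] sub by blast
  have "submodule (line_extension W e)"
    by (rule submodule_line_extension[OF W e(3)]) (use scalar e(1) in blast)
  moreover have "W \<subset> line_extension W e"
    using subset_line_extension[OF sW, of e] e(2) by blast
  moreover have "line_extension W e \<subseteq> W'"
  proof
    fix w assume "w \<in> line_extension W e"
    then obtain d where d: "w - sU d e \<in> W'" using sub by (auto simp: line_extension_def)
    have "w = (w - sU d e) + sU d e" by simp
    also have "\<dots> \<in> W'" using d e(1) by (intro V.subspace_add V.subspace_scale sW')
    finally show "w \<in> W'" .
  qed
  ultimately have "W' = line_extension W e" using cover by blast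
  then show "\<exists>e c. e \<in> W' \<and> e \<notin> W \<and> W' = line_extension W e \<and> X e - sU c e \<in> W"
    using e by blast
qed

end

section \<open>Maximal flags of submodules\<close>

context lie_module
begin

text \<open>A composition series of length \<open>m\<close> as an indexed family; values beyond \<open>m\<close> are arbitrary.\<close>

definition maximal_flag :: "nat \<Rightarrow> (nat \<Rightarrow> 'u set) \<Rightarrow> bool" where
  "maximal_flag m U \<longleftrightarrow> U 0 = {0} \<and> U m = UNIV \<and> (\<forall>i\<le>m. submodule (U i)) \<and>
     (\<forall>i<m. U i \<subset> U (Suc i) \<and> \<not> (\<exists>W. submodule W \<and> U i \<subset> W \<and> W \<subset> U (Suc i)))"

lemma composition_series_iff:
  "composition_series Ws \<longleftrightarrow> Ws \<noteq> [] \<and> maximal_flag (length Ws - 1) ((!) Ws)"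
proof (cases "Ws = []")
  case False
  then obtain n where n: "length Ws = Suc n" by (cases Ws) auto
  show ?thesis
    using False
    by (simp add: composition_series_def maximal_flag_def n hd_conv_nth last_conv_nth
        all_set_conv_all_nth less_Suc_eq_le Suc_le_eq)
qed (simp add: composition_series_def)

end

locale uniserial_module = split_module sg br sU act BU x A
  for sg :: "'f::alg_closed_field \<Rightarrow> 'g::ab_group_add \<Rightarrow> 'g"
    and br :: "'g \<Rightarrow> 'g \<Rightarrow> 'g"
    and sU :: "'f \<Rightarrow> 'u::ab_group_add \<Rightarrow> 'u"
    and act :: "'g \<Rightarrow> 'u \<Rightarrow> 'u"
    and BU :: "'u set" and x :: 'g and A :: "'g set" +
  fixes m :: nat and U :: "nat \<Rightarrow> 'u set"
  assumes flag: "maximal_flag m U"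
    and unique: "maximal_flag m U' \<Longrightarrow> i \<le> m \<Longrightarrow> U' i = U i"
begin

lemma U_0 [simp]: "U 0 = {0}" and U_m: "U m = UNIV"
  and submodule_U: "i \<le> m \<Longrightarrow> submodule (U i)"
  and U_psubset: "i < m \<Longrightarrow> U i \<subset> U (Suc i)"
  and U_cover: "i < m \<Longrightarrow> \<not> (\<exists>W. submodule W \<and> U i \<subset> W \<and> W \<subset> U (Suc i))"
  using flag by (simp_all add: maximal_flag_def)

lemma subspace_U: "i \<le> m \<Longrightarrow> V.subspace (U i)"
  and act_U: "i \<le> m \<Longrightarrow> w \<in> U i \<Longrightarrow> act y w \<in> U i"
  using submodule_U by (auto simp: submodule_def)

lemma U_Suc:
  assumes i: "i < m" and e: "e \<in> U (Suc i)" "e \<notin> U i"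
  shows "U (Suc i) = line_extension (U i) e"
proof -
  have sub: "V.subspace (U i)" using i by (intro subspace_U) simp
  obtain e' where e': "U (Suc i) = line_extension (U i) e'"
    using minimal_extension(1)[OF submodule_U submodule_U U_psubset[OF i] U_cover[OF i]] i by auto
  obtain c where c: "e - sU c e' \<in> U i" using e(1) e' by (auto simp: line_extension_def)
  have c0: "c \<noteq> 0" using c e(2) by auto
  show ?thesis
  proof
    show "U (Suc i) \<subseteq> line_extension (U i) e"
    proof
      fix w assume "w \<in> U (Suc i)"
      then obtain d where d: "w - sU d e' \<in> U i" using e' by (auto simp: line_extension_def)
      have "w - sU (d / c) e = (w - sU d e') - sU (d / c) (e - sU c e')"
        using c0 by (simp add: lin_simps)
      also have "\<dots> \<in> U i" by (intro V.subspace_diff V.subspace_scale sub d c)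
      finally show "w \<in> line_extension (U i) e" by (auto simp: line_extension_def)
    qed
    show "line_extension (U i) e \<subseteq> U (Suc i)"
    proof
      fix w assume "w \<in> line_extension (U i) e"
      then obtain d where "w - sU d e \<in> U (Suc i)" using U_psubset[OF i] by (auto simp: line_extension_def)
      moreover have "V.subspace (U (Suc i))" using i by (intro subspace_U) simp
      ultimately have "(w - sU d e) + sU d e \<in> U (Suc i)"
        using e(1) by (intro V.subspace_add V.subspace_scale)
      then show "w \<in> U (Suc i)" by simp
    qed
  qed
qed

lemma U_decompose:
  assumes "i < m" "e \<in> U (Suc i)" "e \<notin> U i" "w \<in> U (Suc i)"
  obtains c r where "r \<in> U i" "w = sU c e + r"
proof -
  obtain c where c: "w - sU c e \<in> U i" using U_Suc[OF assms(1-3)] assms(4) by (auto simp: line_extension_def)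
  show ?thesis by (rule that[OF c, of c]) simp
qed

lemma ex_U_diff: "i < m \<Longrightarrow> \<exists>e. e \<in> U (Suc i) \<and> e \<notin> U i"
  using U_psubset by blast

lemma dim_U: "i \<le> m \<Longrightarrow> V.dim (U i) = i"
proof (induction i)
  case 0 then show ?case by simp
next
  case (Suc i)
  then obtain e where e: "e \<in> U (Suc i)" "e \<notin> U i" using ex_U_diff[of i] by (auto simp: Suc_le_eq)
  have sp: "V.span (U i) = U i" using Suc subspace_U by (simp add: V.span_eq_iff)
  have "U (Suc i) = V.span (insert e (U i))"
    using U_Suc[OF _ e] Suc.prems by (simp add: line_extension_def V.span_insert sp)
  then have "V.dim (U (Suc i)) = V.dim (insert e (U i))" by simp
  then show ?case using Suc e by (simp add: V.dim_insert sp)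
qed

lemma U_mono: "i \<le> j \<Longrightarrow> j \<le> m \<Longrightarrow> U i \<subseteq> U j"
proof (induction j)
  case (Suc j) then show ?case using U_psubset[of j] by (cases "i = Suc j") auto
qed simp

lemma dim_strict:
  assumes "V.subspace W" "V.subspace W'" "W \<subset> W'" shows "V.dim W < V.dim W'"
  using V.dim_psubset[of W W'] assms by (simp add: V.span_eq_iff[THEN iffD2])

text \<open>Since all factors are one-dimensional, replacing \<open>U (Suc i)\<close> by \<open>W\<close> gives again a maximal flag: the
  dimensions leave no room for further submodules. This is the only place where uniqueness of the
  composition series is used.\<close>

lemma between_unique:
  assumes i: "Suc i < m" and W: "submodule W" "U i \<subset> W" "W \<subset> U (Suc (Suc i))"
  shows "W = U (Suc i)"
proof -
  define U' where "U' = U(Suc i := W)"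
  have sW: "V.subspace W" using W(1) by (simp add: submodule_def)
  have dim_W: "V.dim W = Suc i"
    using dim_strict[OF _ sW W(2)] dim_strict[OF sW _ W(3)] i by (simp add: subspace_U dim_U)
  have sub': "submodule (U' j)" if "j \<le> m" for j
    using that W(1) by (simp add: U'_def submodule_U)
  have dim': "V.dim (U' j) = j" if "j \<le> m" for j
    using that dim_W by (simp add: U'_def dim_U)
  have "maximal_flag m U'"
    unfolding maximal_flag_def
  proof (intro conjI allI impI)
    show "U' 0 = {0}" "U' m = UNIV" using i by (simp_all add: U'_def U_m)
    show "submodule (U' j)" if "j \<le> m" for j by (fact sub'[OF that])
    fix j assume j: "j < m"
    show "U' j \<subset> U' (Suc j)"
      using j W U_psubset[OF j] by (auto simp: U'_def)
    show "\<not> (\<exists>Z. submodule Z \<and> U' j \<subset> Z \<and> Z \<subset> U' (Suc j))"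
    proof
      assume "\<exists>Z. submodule Z \<and> U' j \<subset> Z \<and> Z \<subset> U' (Suc j)"
      then obtain Z where Z: "submodule Z" "U' j \<subset> Z" "Z \<subset> U' (Suc j)" by blast
      have "V.dim (U' j) < V.dim Z" "V.dim Z < V.dim (U' (Suc j))"
        using Z sub'[of j] sub'[of "Suc j"] j
        by (auto simp: submodule_def intro!: dim_strict)
      then show False using dim' j by simp
    qed
  qed
  then have "U' (Suc i) = U (Suc i)" using i by (intro unique) auto
  then show ?thesis by (simp add: U'_def)
qed

section \<open>Generalized eigenvectors adapted to the flag\<close>

definition X_minus :: "'f \<Rightarrow> 'u \<Rightarrow> 'u" where
  "X_minus c w = X w - sU c w"

definition gen_eigenspace :: "'f \<Rightarrow> 'u set" where
  "gen_eigenspace c = {w. \<exists>n. (X_minus c ^^ n) w = 0}"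

text \<open>The eigenvalue of \<open>x\<close> on the one-dimensional factor \<open>U (Suc i) / U i\<close>; meaningful for \<open>i < m\<close>.\<close>

definition eigval :: "nat \<Rightarrow> 'f" where
  "eigval i = (SOME c. \<forall>w\<in>U (Suc i). X_minus c w \<in> U i)"

lemma X_minus_eigval:
  assumes i: "i < m" and w: "w \<in> U (Suc i)"
  shows "X_minus (eigval i) w \<in> U i"
proof -
  have sub: "V.subspace (U i)" using i by (intro subspace_U) simp
  obtain e c where e: "e \<in> U (Suc i)" "e \<notin> U i" "X e - sU c e \<in> U i"
    using minimal_extension(1)[OF submodule_U submodule_U U_psubset[OF i] U_cover[OF i]] i by auto
  have "X_minus c w \<in> U i" if w: "w \<in> U (Suc i)" for w
  proof -
    obtain d r where d: "r \<in> U i" "w = sU d e + r" by (rule U_decompose[OF i e(1,2) w])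
    have "X_minus c w = sU d (X e - sU c e) + (X r - sU c r)"
      by (simp add: X_minus_def d(2) lin_simps mult.commute)
    also have "\<dots> \<in> U i"
      using i by (intro V.subspace_add V.subspace_diff V.subspace_scale sub e(3) d(1) act_U) simp
    finally show ?thesis .
  qed
  then have "\<exists>c. \<forall>w\<in>U (Suc i). X_minus c w \<in> U i" by blast
  then have "\<forall>w\<in>U (Suc i). X_minus (eigval i) w \<in> U i" unfolding eigval_def by (rule someI_ex)
  then show ?thesis using w by blast
qed

lemma X_minus_hom: "module_hom sU sU (X_minus c)"
  by unfold_locales (simp_all add: X_minus_def lin_simps mult.commute)

lemmas X_minus_pow_hom = module_hom_funpow[OF X_minus_hom]

lemma X_minus_U: "i \<le> m \<Longrightarrow> w \<in> U i \<Longrightarrow> X_minus c w \<in> U i"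
  unfolding X_minus_def by (intro V.subspace_diff V.subspace_scale subspace_U act_U)

text \<open>On the factor \<open>U (Suc i) / U i\<close> the operator \<open>X - c\<close> is multiplication by \<open>eigval i - c\<close>.\<close>

lemma X_minus_pow_factor:
  assumes i: "i < m" and w: "w \<in> U (Suc i)"
  shows "(X_minus c ^^ n) w \<in> U (Suc i) \<and> (X_minus c ^^ n) w - sU ((eigval i - c) ^ n) w \<in> U i"
proof (induction n)
  case 0 then show ?case using w i V.subspace_0[OF subspace_U[of i]] by simp
next
  case (Suc n)
  have sub: "V.subspace (U i)" using i by (intro subspace_U) simp
  let ?v = "(X_minus c ^^ n) w" and ?k = "(eigval i - c) ^ n"
  have "X_minus c ?v - sU ((eigval i - c) * ?k) w = X_minus (eigval i) ?v + sU (eigval i - c) (?v - sU ?k w)"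
    by (simp add: X_minus_def lin_simps)
  also have "\<dots> \<in> U i"
    using Suc by (intro V.subspace_add V.subspace_scale sub X_minus_eigval i) auto
  finally show ?case using Suc X_minus_U[of "Suc i"] i by simp
qed

lemma subspace_gen_eigenspace: "V.subspace (gen_eigenspace c)"
proof (rule V.subspaceI)
  show "0 \<in> gen_eigenspace c" by (auto simp: gen_eigenspace_def intro!: exI[of _ 0])
next
  fix a b assume "a \<in> gen_eigenspace c" "b \<in> gen_eigenspace c"
  then obtain i j where ij: "(X_minus c ^^ i) a = 0" "(X_minus c ^^ j) b = 0" by (auto simp: gen_eigenspace_def)
  have "(X_minus c ^^ (j + i)) a = 0" "(X_minus c ^^ (i + j)) b = 0"
    using ij module_hom.zero[OF X_minus_pow_hom] by (simp_all only: funpow_add o_apply)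
  then have "(X_minus c ^^ (i + j)) (a + b) = 0"
    by (simp add: module_hom.add[OF X_minus_pow_hom] add.commute)
  then show "a + b \<in> gen_eigenspace c" by (auto simp: gen_eigenspace_def)
next
  fix d a assume "a \<in> gen_eigenspace c"
  then show "sU d a \<in> gen_eigenspace c" by (auto simp: gen_eigenspace_def module_hom.scale[OF X_minus_pow_hom])
qed

text \<open>A generalized eigenvector cannot have a non-zero image in a factor that belongs to another
  eigenvalue. Iterating this localizes generalized eigenvectors in the flag and replaces the
  decomposition of the module into generalized eigenspaces.\<close>

lemma gen_eigenspace_drop:
  assumes i: "i < m" and w: "w \<in> U (Suc i)" "w \<in> gen_eigenspace c" and c: "c \<noteq> eigval i"
  shows "w \<in> U i"
proof -
  have sub: "V.subspace (U i)" using i by (intro subspace_U) simp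
  obtain n where "(X_minus c ^^ n) w = 0" using w(2) by (auto simp: gen_eigenspace_def)
  then have "- sU ((eigval i - c) ^ n) w \<in> U i" using X_minus_pow_factor[OF i w(1), of n c] by simp
  then have "sU (- inverse ((eigval i - c) ^ n)) (- sU ((eigval i - c) ^ n) w) \<in> U i"
    by (rule V.subspace_scale[OF sub])
  then show ?thesis using c by simp
qed

lemma gen_eigenspace_descend:
  assumes "l \<le> k" "k \<le> m" "w \<in> gen_eigenspace c" "w \<in> U k" "\<And>j. l \<le> j \<Longrightarrow> j < k \<Longrightarrow> c \<noteq> eigval j"
  shows "w \<in> U l"
  using assms
proof (induction k)
  case (Suc k)
  show ?case
  proof (cases "l = Suc k")
    case False
    then have "w \<in> U k" using Suc.prems by (intro gen_eigenspace_drop[of k w c]) auto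
    then show ?thesis using Suc False by auto
  qed (use Suc.prems in simp)
qed simp

text \<open>Start with any vector of \<open>U (Suc i) - U i\<close> and push its image under a power of \<open>X - eigval i\<close>
  down the flag. A factor with the same eigenvalue is passed by one more application; on a factor
  with another eigenvalue the power is invertible, so a correction term from \<open>U (Suc j)\<close> removes
  the component there.\<close>

lemma generalized_eigenvector_exists:
  assumes i: "i < m"
  shows "\<exists>e. e \<in> U (Suc i) \<and> e \<notin> U i \<and> e \<in> gen_eigenspace (eigval i)"
proof -
  have "\<exists>e n. e \<in> U (Suc i) \<and> e \<notin> U i \<and> (X_minus (eigval i) ^^ n) e \<in> U j" if "j \<le> i" for j
    using that
  proof (induction rule: inc_induct)
    case base
    obtain e where e: "e \<in> U (Suc i)" "e \<notin> U i" using ex_U_diff[OF i] by blast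
    then have "(X_minus (eigval i) ^^ 1) e \<in> U i" using X_minus_eigval[OF i] by simp
    then show ?case using e by blast
  next
    case (step j)
    then obtain e n where e: "e \<in> U (Suc i)" "e \<notin> U i" and f: "(X_minus (eigval i) ^^ n) e \<in> U (Suc j)"
      by blast
    let ?f = "(X_minus (eigval i) ^^ n) e"
    have j: "j < m" using step i by simp
    have sub: "V.subspace (U j)" using j by (intro subspace_U) simp
    show ?case
    proof (cases "eigval j = eigval i")
      case True
      then have "(X_minus (eigval i) ^^ Suc n) e \<in> U j" using X_minus_eigval[OF j f] by simp
      then show ?thesis using e by blast
    next
      case False
      let ?c = "(eigval j - eigval i) ^ n"
      have c: "?c \<noteq> 0" using False by simp
      define w where "w = sU (inverse ?c) ?f"
      have "w \<in> U (Suc j)"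
        unfolding w_def using f j by (intro V.subspace_scale subspace_U) simp_all
      then have w: "w \<in> U i" using U_mono[of "Suc j" i] step i by auto
      have "(X_minus (eigval i) ^^ n) (e - w) = sU (- inverse ?c) ((X_minus (eigval i) ^^ n) ?f - sU ?c ?f)"
        using c by (simp add: w_def module_hom.diff[OF X_minus_pow_hom] module_hom.scale[OF X_minus_pow_hom] lin_simps)
      also have "\<dots> \<in> U j"
        using X_minus_pow_factor[OF j f] by (intro V.subspace_scale sub) simp
      finally have "(X_minus (eigval i) ^^ n) (e - w) \<in> U j" .
      moreover have "e - w \<notin> U i"
        using e(2) w V.subspace_add[OF subspace_U, of i "e - w" w] i by auto
      moreover have "e - w \<in> U (Suc i)"
        using e(1) w i U_psubset[OF i] by (intro V.subspace_diff subspace_U) auto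
      ultimately show ?thesis by blast
    qed
  qed
  from this[of 0] show ?thesis by (auto simp: gen_eigenspace_def)
qed

text \<open>The scalars by which \<open>u\<close> acts on the factors agree. They are \<open>0\<close> for non-zero weights. For weight
  \<open>0\<close>, distinct scalars on two consecutive factors would split \<open>U (i + 2) / U i\<close>: the eigenspace of
  the upper scalar is a submodule different from \<open>U (i + 1) / U i\<close>, against uniseriality.\<close>

lemma weight_scalar:
  assumes u: "u \<in> E \<delta>"
  shows "\<exists>\<mu>. (\<delta> \<noteq> 0 \<longrightarrow> \<mu> = 0) \<and> (\<forall>i<m. \<forall>w\<in>U (Suc i). act u w - sU \<mu> w \<in> U i)"
proof -
  have "\<exists>\<mu>. (\<delta> \<noteq> 0 \<longrightarrow> \<mu> = 0) \<and> (\<forall>w\<in>U (Suc i). act u w - sU \<mu> w \<in> U i)" if "i < m" for i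
    using minimal_extension(2)[OF submodule_U submodule_U U_psubset[OF that] U_cover[OF that] u] that
    by simp
  then obtain \<mu> where \<mu>0: "\<And>i. i < m \<Longrightarrow> \<delta> \<noteq> 0 \<longrightarrow> \<mu> i = 0"
    and \<mu>: "\<And>i w. i < m \<Longrightarrow> w \<in> U (Suc i) \<Longrightarrow> act u w - sU (\<mu> i) w \<in> U i"
    by metis
  have step: "\<mu> (Suc i) = \<mu> i" if i: "Suc i < m" for i
  proof (rule ccontr)
    assume neq: "\<mu> (Suc i) \<noteq> \<mu> i"
    have sub: "V.subspace (U i)" "V.subspace (U (Suc i))" using i by (auto intro: subspace_U)
    let ?K = "{w \<in> U (Suc (Suc i)). act u w - sU (\<mu> (Suc i)) w \<in> U i}"
    have K: "submodule ?K"
      by (rule submodule_weight_kernel[OF submodule_U submodule_U u]) (use i \<mu>0 in auto)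
    obtain e where e: "e \<in> U (Suc (Suc i))" "e \<notin> U (Suc i)" using ex_U_diff[OF i] by blast
    define w where "w = act u e - sU (\<mu> i) e"
    have in_Suc: "act u e - sU (\<mu> (Suc i)) e \<in> U (Suc i)" using \<mu>[OF i e(1)] .
    have w_mem: "w \<in> U (Suc (Suc i))"
      unfolding w_def using i e by (intro V.subspace_diff V.subspace_scale subspace_U act_U) auto
    have w_notin: "w \<notin> U (Suc i)"
    proof
      assume "w \<in> U (Suc i)"
      then have "sU (inverse (\<mu> (Suc i) - \<mu> i)) (w - (act u e - sU (\<mu> (Suc i)) e)) \<in> U (Suc i)"
        by (intro V.subspace_scale V.subspace_diff sub in_Suc)
      moreover have "w - (act u e - sU (\<mu> (Suc i)) e) = sU (\<mu> (Suc i) - \<mu> i) e"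
        by (simp add: w_def lin_simps)
      ultimately show False using e(2) neq by simp
    qed
    have "act u w - sU (\<mu> (Suc i)) w =
        act u (act u e - sU (\<mu> (Suc i)) e) - sU (\<mu> i) (act u e - sU (\<mu> (Suc i)) e)"
      by (simp add: w_def lin_simps algebra_simps)
    also have "\<dots> \<in> U i" using \<mu>[of i] in_Suc i by simp
    finally have w_K: "w \<in> ?K" using w_mem by simp
    have "U i \<subseteq> ?K"
      using U_psubset[of i] U_psubset[of "Suc i"] i
      by (auto intro!: V.subspace_diff V.subspace_scale sub act_U)
    then have "U i \<subset> ?K" using w_K w_notin U_psubset[of i] i by auto
    then have "?K = U (Suc i) \<or> ?K = U (Suc (Suc i))"
      using between_unique[OF i K] by auto
    then have all: "?K = U (Suc (Suc i))" using w_K w_notin by blast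
    obtain d where d: "d \<in> U (Suc i)" "d \<notin> U i" using ex_U_diff[of i] i by auto
    have "act u d - sU (\<mu> (Suc i)) d \<in> U i" using d(1) all U_psubset[OF i] by blast
    moreover have "act u d - sU (\<mu> i) d \<in> U i" using \<mu>[of i] d(1) i by simp
    ultimately have "sU (inverse (\<mu> (Suc i) - \<mu> i))
        ((act u d - sU (\<mu> i) d) - (act u d - sU (\<mu> (Suc i)) d)) \<in> U i"
      by (rule V.subspace_scale[OF sub(1) V.subspace_diff[OF sub(1)], rotated])
    moreover have "(act u d - sU (\<mu> i) d) - (act u d - sU (\<mu> (Suc i)) d) = sU (\<mu> (Suc i) - \<mu> i) d"
      by (simp add: lin_simps)
    ultimately show False using d(2) neq by simp
  qed
  have const: "i < m \<Longrightarrow> \<mu> i = \<mu> 0" for i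
    by (induction i) (use step in auto)
  show ?thesis
  proof (cases "m = 0")
    case True then show ?thesis by (intro exI[of _ 0]) auto
  next
    case False
    have "act u w - sU (\<mu> 0) w \<in> U i" if "i < m" "w \<in> U (Suc i)" for i w
      using \<mu>[OF that] const[OF that(1)] by simp
    then show ?thesis using \<mu>0[of 0] False by (intro exI[of _ "\<mu> 0"]) simp
  qed
qed

section \<open>Links between consecutive factors\<close>

text \<open>Candidates for linking consecutive factors. They are families \<open>T\<close> indexed by the generalized
  eigenvalue \<open>c\<close> of the argument: the nilpotent part of a weight vector (independent of \<open>c\<close>), or
  \<open>X - c\<close>, which is the nilpotent part of \<open>X\<close> on the generalized eigenspace of \<open>c\<close>. The index makes
  it possible to treat \<open>X\<close> like a weight vector of weight \<open>0\<close> before \<open>X\<close> is known to be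
  diagonalizable.\<close>

definition weight_family :: "'f \<Rightarrow> ('f \<Rightarrow> 'u \<Rightarrow> 'u) \<Rightarrow> bool" where
  "weight_family \<delta> T \<longleftrightarrow> (\<delta> = 0 \<and> T = X_minus) \<or>
     (\<exists>u\<in>E \<delta>. \<exists>\<mu>. (\<delta> \<noteq> 0 \<longrightarrow> \<mu> = 0) \<and>
        (\<forall>i<m. \<forall>w\<in>U (Suc i). act u w - sU \<mu> w \<in> U i) \<and> T = (\<lambda>c w. act u w - sU \<mu> w))"

lemma weight_family_weight:
  assumes u: "u \<in> E \<delta>" "\<delta> \<noteq> 0"
  shows "weight_family \<delta> (\<lambda>c. act u)"
proof -
  have "\<forall>i<m. \<forall>w\<in>U (Suc i). act u w - sU 0 w \<in> U i"
    using weight_scalar[OF u(1)] u(2) by auto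
  then show ?thesis
    unfolding weight_family_def using u by (intro disjI2 bexI[of _ u] exI[of _ 0]) simp_all
qed

lemma weight_family_X_minus: "weight_family 0 X_minus"
  by (simp add: weight_family_def)

lemma weight_family_cases:
  assumes "weight_family \<delta> T"
  obtains "\<delta> = 0" "T = X_minus"
  | u \<mu> where "u \<in> E \<delta>" "\<delta> \<noteq> 0 \<Longrightarrow> \<mu> = 0" "T = (\<lambda>c w. act u w - sU \<mu> w)"
      "\<And>i w. i < m \<Longrightarrow> w \<in> U (Suc i) \<Longrightarrow> act u w - sU \<mu> w \<in> U i"
  using assms unfolding weight_family_def by (elim disjE bexE exE conjE) auto

lemma weight_family_hom: "weight_family \<delta> T \<Longrightarrow> module_hom sU sU (T c)"
  by (erule weight_family_cases) (simp add: X_minus_hom, unfold_locales, simp_all add: lin_simps mult.commute)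

lemma weight_family_lower:
  assumes "weight_family \<delta> T" "i < m" "w \<in> U (Suc i)" "\<delta> = 0 \<Longrightarrow> c = eigval i"
  shows "T c w \<in> U i"
  using assms(1) by (cases rule: weight_family_cases) (use assms X_minus_eigval in auto)

lemma weight_family_commute_X_minus:
  assumes "weight_family \<delta> T"
  shows "X_minus (c + \<delta>) (T c w) = T c (X_minus c w)"
  using assms
proof (cases rule: weight_family_cases)
  case (2 u \<mu>)
  have "sU \<delta> (sU \<mu> w) = 0" using 2(2) by (cases "\<delta> = 0") auto
  then show ?thesis
    by (simp add: 2(3) X_minus_def lin_simps act_weight[OF 2(1)] algebra_simps)
qed simp

text \<open>With the index updated by the weight of the operator applied first, all families commute.\<close>

lemma weight_family_commute:
  assumes "weight_family \<delta> T" "weight_family \<delta>' T'"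
  shows "T' (c + \<delta>) (T c w) = T (c + \<delta>') (T' c w)"
  using assms(1)
proof (cases rule: weight_family_cases)
  case 1
  then show ?thesis using weight_family_commute_X_minus[OF assms(2)] by simp
next
  case (2 u \<mu>)
  note T = 2
  from assms(2) show ?thesis
  proof (cases rule: weight_family_cases)
    case 1
    then show ?thesis using weight_family_commute_X_minus[OF assms(1)] T(3) by simp
  next
    case (2 u' \<mu>')
    have "act u' (act u w) = act u (act u' w)"
      using act_commute T(1) 2(1) eigenspace_subset by blast
    then show ?thesis by (simp add: T(3) 2(3) lin_simps algebra_simps)
  qed
qed

lemma weight_family_gen_eigenspace:
  assumes T: "weight_family \<delta> T" and w: "w \<in> gen_eigenspace c"
  shows "T c w \<in> gen_eigenspace (c + \<delta>)"
proof -
  have "(X_minus (c + \<delta>) ^^ n) (T c w) = T c ((X_minus c ^^ n) w)" for n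
    by (induction n) (simp_all add: weight_family_commute_X_minus[OF T])
  moreover obtain n where "(X_minus c ^^ n) w = 0" using w by (auto simp: gen_eigenspace_def)
  ultimately have "(X_minus (c + \<delta>) ^^ n) (T c w) = 0" using module_hom.zero[OF weight_family_hom[OF T]] by simp
  then show ?thesis by (auto simp: gen_eigenspace_def)
qed

text \<open>If every candidate sent \<open>e\<close> into \<open>U i\<close>, then \<open>e\<close> would span a submodule modulo \<open>U i\<close>, complementary
  to \<open>U (Suc i)\<close>, contradicting \<open>between_unique\<close>.\<close>

lemma factor_link:
  assumes i: "Suc i < m" and e: "e \<in> U (Suc (Suc i))" "e \<notin> U (Suc i)" "e \<in> gen_eigenspace (eigval (Suc i))"
  obtains \<delta> T where "weight_family \<delta> T" "T (eigval (Suc i)) e \<in> U (Suc i)" "T (eigval (Suc i)) e \<notin> U i"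
    "eigval i = eigval (Suc i) + \<delta>" "T (eigval (Suc i)) e \<in> gen_eigenspace (eigval i)"
proof -
  let ?c = "eigval (Suc i)"
  have sub: "V.subspace (U i)" using i by (intro subspace_U) simp
  have "\<exists>\<delta> T. weight_family \<delta> T \<and> T ?c e \<notin> U i"
  proof (rule ccontr)
    assume neg: "\<not> ?thesis"
    have scalar: "\<exists>\<mu>. act u e - sU \<mu> e \<in> U i" if u: "u \<in> E \<delta>" for u \<delta>
    proof -
      obtain \<mu> where "\<delta> \<noteq> 0 \<longrightarrow> \<mu> = 0" "\<forall>i<m. \<forall>w\<in>U (Suc i). act u w - sU \<mu> w \<in> U i"
        using weight_scalar[OF u] by blast
      then have "weight_family \<delta> (\<lambda>c w. act u w - sU \<mu> w)" using u by (auto simp: weight_family_def)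
      then show ?thesis using neg by blast
    qed
    have "X_minus ?c e \<in> U i" using neg weight_family_X_minus by blast
    then have "X e - sU ?c e \<in> U i" by (simp add: X_minus_def)
    then have mod: "submodule (line_extension (U i) e)"
      using i by (intro submodule_line_extension submodule_U scalar) auto
    obtain d where d: "d \<in> U (Suc i)" "d \<notin> U i" using ex_U_diff[of i] i by auto
    have "d \<notin> line_extension (U i) e"
    proof
      assume "d \<in> line_extension (U i) e"
      then obtain k where k: "d - sU k e \<in> U i" by (auto simp: line_extension_def)
      then have "k \<noteq> 0" using d(2) by auto
      have sub': "V.subspace (U (Suc i))" using i by (intro subspace_U) simp
      have "d - sU k e \<in> U (Suc i)" using k U_psubset[of i] i by auto
      then have "sU (inverse k) (d - (d - sU k e)) \<in> U (Suc i)"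
        by (rule V.subspace_scale[OF sub' V.subspace_diff[OF sub' d(1)]])
      then show False using e(2) \<open>k \<noteq> 0\<close> by simp
    qed
    moreover have "d \<in> U (Suc (Suc i))" using d(1) U_psubset[OF i] by blast
    moreover have "line_extension (U i) e \<subseteq> U (Suc (Suc i))"
    proof
      fix w assume "w \<in> line_extension (U i) e"
      then obtain k where "w - sU k e \<in> U i" by (auto simp: line_extension_def)
      then have "(w - sU k e) + sU k e \<in> U (Suc (Suc i))"
        using U_mono[of i "Suc (Suc i)"] i e(1) by (intro V.subspace_add V.subspace_scale subspace_U) auto
      then show "w \<in> U (Suc (Suc i))" by simp
    qed
    moreover have "U i \<subset> line_extension (U i) e"
      using subset_line_extension[OF sub, of e] e(2) U_psubset[of i] i by auto
    ultimately have "line_extension (U i) e = U (Suc i)"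
      by (intro between_unique[OF i mod]) auto
    then show False using subset_line_extension(2)[OF sub] e(2) by blast
  qed
  then obtain \<delta> T where T: "weight_family \<delta> T" "T ?c e \<notin> U i" by blast
  have mem: "T ?c e \<in> U (Suc i)" using weight_family_lower[OF T(1) i e(1)] by simp
  have gen: "T ?c e \<in> gen_eigenspace (?c + \<delta>)" by (rule weight_family_gen_eigenspace[OF T(1) e(3)])
  have "eigval i = ?c + \<delta>" using gen_eigenspace_drop[of i, OF _ mem gen] i T(2) by force
  then show ?thesis using that[OF T(1) mem T(2)] gen by simp
qed

text \<open>Let \<open>T\<close> and \<open>T'\<close> link the upper and the lower pair of factors, with weights \<open>\<delta>\<close> and \<open>\<delta>'\<close>. The
  composite \<open>T' T e\<close> is non-zero modulo \<open>U i\<close>. In the opposite order, \<open>T' e\<close> has generalized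
  eigenvalue \<open>eigval (i + 2) + \<delta>'\<close>; if this differs from \<open>eigval (i + 1)\<close>, then \<open>T' e\<close> falls into
  \<open>U (i + 1)\<close> and \<open>T T' e\<close> into \<open>U i\<close>, contradicting commutation.\<close>

lemma eigval_step:
  assumes i: "Suc (Suc i) < m"
  shows "eigval i - eigval (Suc i) = eigval (Suc i) - eigval (Suc (Suc i))"
proof -
  let ?c = "eigval (Suc (Suc i))"
  obtain e where e: "e \<in> U (Suc (Suc (Suc i)))" "e \<notin> U (Suc (Suc i))" "e \<in> gen_eigenspace ?c"
    using generalized_eigenvector_exists[OF i] by blast
  obtain \<delta> T where T: "weight_family \<delta> T" "T ?c e \<in> U (Suc (Suc i))" "T ?c e \<notin> U (Suc i)"
    "eigval (Suc i) = ?c + \<delta>" "T ?c e \<in> gen_eigenspace (eigval (Suc i))"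
    by (rule factor_link[OF i e])
  obtain \<delta>' T' where T': "weight_family \<delta>' T'" "T' (eigval (Suc i)) (T ?c e) \<notin> U i" "eigval i = eigval (Suc i) + \<delta>'"
    by (rule factor_link[OF Suc_lessD[OF i] T(2,3,5)])
  have "\<delta> = \<delta>'"
  proof (rule ccontr)
    assume neq: "\<delta> \<noteq> \<delta>'"
    have "T' ?c e \<in> U (Suc (Suc i))" using weight_family_lower[OF T'(1) i e(1)] by simp
    moreover have "T' ?c e \<in> gen_eigenspace (?c + \<delta>')" by (rule weight_family_gen_eigenspace[OF T'(1) e(3)])
    moreover have "?c + \<delta>' \<noteq> eigval (Suc i)" using T(4) neq by simp
    ultimately have "T' ?c e \<in> U (Suc i)" by (rule gen_eigenspace_drop[OF Suc_lessD[OF i]])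
    then have "T (?c + \<delta>') (T' ?c e) \<in> U i"
      using weight_family_lower[OF T(1), of i "T' ?c e" "?c + \<delta>'"] i T(4) T'(3) by simp
    then show False using T'(2) weight_family_commute[OF T(1) T'(1), of ?c e] T(4) by simp
  qed
  then show ?thesis using T(4) T'(3) by simp
qed

section \<open>The eigenvalues form an arithmetic progression\<close>

definition step :: 'f where
  "step = eigval 0 - eigval 1"

lemma eigval_diff: "Suc i < m \<Longrightarrow> eigval i = eigval (Suc i) + step"
proof (induction i)
  case 0 then show ?case by (simp add: step_def)
next
  case (Suc i)
  then have "eigval i = eigval (Suc i) + step" by simp
  then show ?case using eigval_step[OF Suc.prems] by (simp add: algebra_simps)
qed

lemma eigval_eq: "i < m \<Longrightarrow> eigval i = eigval 0 - of_nat i * step"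
proof (induction i)
  case (Suc i) then show ?case using eigval_diff[OF Suc.prems] by (simp add: algebra_simps)
qed simp

text \<open>A weight vector of weight \<open>\<delta>\<close> maps generalized eigenvectors for \<open>eigval 0\<close> to those for
  \<open>eigval 0 + \<delta>\<close>, and there are none of the latter.\<close>

lemma weight_zero_if_eigval_constant:
  assumes const: "\<And>i. i < m \<Longrightarrow> eigval i = eigval 0" and u: "u \<in> E \<delta>" "\<delta> \<noteq> 0"
  shows "act u w = 0"
proof -
  have "act u w = 0" if "i \<le> m" "w \<in> U i" for i w
    using that
  proof (induction i arbitrary: w)
    case (Suc i)
    obtain e where e: "e \<in> U (Suc i)" "e \<notin> U i" "e \<in> gen_eigenspace (eigval i)"
      using generalized_eigenvector_exists[of i] Suc.prems by auto
    have "weight_family \<delta> (\<lambda>c. act u)" by (rule weight_family_weight[OF u])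
    from weight_family_gen_eigenspace[OF this e(3)] have "act u e \<in> gen_eigenspace (eigval i + \<delta>)" .
    moreover have "eigval i + \<delta> \<noteq> eigval j" if "j < m" for j
      using const[OF that] const[of i] Suc.prems u(2) by simp
    ultimately have "act u e \<in> U 0"
      by (intro gen_eigenspace_descend[of 0 m "act u e" "eigval i + \<delta>"]) (simp_all add: U_m)
    moreover have "i < m" using Suc.prems by simp
    then obtain c r where r: "r \<in> U i" "w = sU c e + r"
      by (rule U_decompose[OF _ e(1,2) Suc.prems(2)])
    moreover have "act u r = 0" using Suc r by simp
    ultimately show ?case by (simp add: act_add act_scale)
  qed simp
  from this[of m w] show ?thesis by (simp add: U_m)
qed

end

section \<open>Simple spectrum\<close>

text \<open>The hypothesis on the characteristic makes \<open>0, ..., m - 1\<close> distinct in the field. Together with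
  non-triviality it makes the eigenvalues of \<open>X\<close> distinct.\<close>

locale ladder_module = uniserial_module sg br sU act BU x A m U
  for sg :: "'f::alg_closed_field \<Rightarrow> 'g::ab_group_add \<Rightarrow> 'g"
    and br :: "'g \<Rightarrow> 'g \<Rightarrow> 'g"
    and sU :: "'f \<Rightarrow> 'u::ab_group_add \<Rightarrow> 'u"
    and act :: "'g \<Rightarrow> 'u \<Rightarrow> 'u"
    and BU :: "'u set" and x :: 'g and A :: "'g set" and m U +
  assumes nontrivial: "\<not> acts_trivially L.derived_algebra"
    and char: "CHAR('f) = 0 \<or> m \<le> CHAR('f)"
begin

lemma eigval_not_constant: "\<exists>i<m. eigval i \<noteq> eigval 0"
proof -
  obtain \<delta> u w where u: "u \<in> E \<delta>" "\<delta> \<noteq> 0" "act u w \<noteq> 0"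
    using nonzero_weight_acts[OF nontrivial] by auto
  show ?thesis
  proof (rule ccontr)
    assume "\<not> ?thesis"
    then have "eigval i = eigval 0" if "i < m" for i using that by blast
    from weight_zero_if_eigval_constant[OF this u(1,2)] u(3) show False by simp
  qed
qed

lemma m_gt_1: "m > 1"
proof -
  obtain i where "i < m" "eigval i \<noteq> eigval 0" using eigval_not_constant by blast
  then show ?thesis by (cases i) auto
qed

lemma step_nonzero: "step \<noteq> 0"
proof
  assume "step = 0"
  then have "eigval i = eigval 0" if "i < m" for i using eigval_eq[OF that] by simp
  then show False using eigval_not_constant by blast
qed

lemma of_nat_inj:
  assumes "i < m" "j < m" "of_nat i = (of_nat j :: 'f)"
  shows "i = j"
proof -
  have *: "\<not> i < j" if "j < m" "of_nat i = (of_nat j :: 'f)" for i j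
  proof
    assume "i < j"
    then have "of_nat (j - i) = (0 :: 'f)" using that(2) by (simp add: of_nat_diff)
    then have "CHAR('f) dvd j - i" by (simp add: of_nat_eq_0_iff_char_dvd)
    then have "CHAR('f) \<le> j - i" "CHAR('f) \<noteq> 0" using \<open>i < j\<close> by (auto intro: dvd_imp_le gr0I)
    moreover have "j - i < m" using that(1) by simp
    ultimately show False using char by auto
  qed
  show ?thesis using *[of j i] *[of i j] assms by simp
qed

lemma eigval_inj: "i < m \<Longrightarrow> j < m \<Longrightarrow> eigval i = eigval j \<Longrightarrow> i = j"
  using of_nat_inj[of i j] step_nonzero by (simp add: eigval_eq[of i] eigval_eq[of j])

lemma eigval_shift: "i \<le> j \<Longrightarrow> j < m \<Longrightarrow> eigval j + of_nat i * step = eigval (j - i)"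
  by (simp add: eigval_eq[of j] eigval_eq[of "j - i"] of_nat_diff algebra_simps)

lemma gen_eigenspace_eigval_U:
  assumes "k < m" "w \<in> gen_eigenspace (eigval k)" shows "w \<in> U (Suc k)"
proof (rule gen_eigenspace_descend[OF _ _ assms(2)])
  show "eigval k \<noteq> eigval j" if "Suc k \<le> j" "j < m" for j
    using eigval_inj[of k j] assms(1) that by auto
qed (use assms(1) in \<open>auto simp: U_m\<close>)

lemma gen_eigenspace_eigval_zero:
  assumes "k < m" "w \<in> gen_eigenspace (eigval k)" "w \<in> U k" shows "w = 0"
proof -
  have "w \<in> U 0"
  proof (rule gen_eigenspace_descend[OF _ _ assms(2,3)])
    show "eigval k \<noteq> eigval j" if "j < k" for j
      using eigval_inj[of k j] assms(1) that by auto
  qed (use assms(1) in auto)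
  then show ?thesis by simp
qed

lemma gen_eigenspace_eigval_eigen:
  assumes "k < m" "w \<in> gen_eigenspace (eigval k)" shows "X w = sU (eigval k) w"
proof -
  have "X_minus (eigval k) w \<in> gen_eigenspace (eigval k)"
    using weight_family_gen_eigenspace[OF weight_family_X_minus assms(2)] by simp
  then have "X_minus (eigval k) w = 0"
    by (rule gen_eigenspace_eigval_zero[OF assms(1) _ X_minus_eigval[OF assms(1) gen_eigenspace_eigval_U[OF assms]]])
  then show ?thesis by (simp add: X_minus_def)
qed

lemma gen_eigenspace_line:
  assumes k: "k < m" and e: "e \<in> gen_eigenspace (eigval k)" "e \<noteq> 0" and w: "w \<in> gen_eigenspace (eigval k)"
  obtains c where "w = sU c e"
proof -
  have "e \<notin> U k" using gen_eigenspace_eigval_zero[OF k e(1)] e(2) by blast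
  then obtain c r where c: "r \<in> U k" "w = sU c e + r"
    by (rule U_decompose[OF k gen_eigenspace_eigval_U[OF k e(1)] _ gen_eigenspace_eigval_U[OF k w]])
  have "w - sU c e \<in> gen_eigenspace (eigval k)" by (intro V.subspace_diff V.subspace_scale subspace_gen_eigenspace w e)
  then have "r = 0" using gen_eigenspace_eigval_zero[OF k] c by simp
  then show ?thesis by (intro that[of c]) (simp add: c(2))
qed

lemma act_gen_eigenspace:
  assumes u: "u \<in> E \<delta>" and w: "w \<in> gen_eigenspace c"
  shows "act u w \<in> gen_eigenspace (c + \<delta>)"
proof -
  obtain \<mu> where \<mu>: "\<delta> \<noteq> 0 \<longrightarrow> \<mu> = 0" "\<forall>i<m. \<forall>w\<in>U (Suc i). act u w - sU \<mu> w \<in> U i"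
    using weight_scalar[OF u] by blast
  then have "weight_family \<delta> (\<lambda>c w. act u w - sU \<mu> w)" using u by (auto simp: weight_family_def)
  from weight_family_gen_eigenspace[OF this w] have "act u w - sU \<mu> w \<in> gen_eigenspace (c + \<delta>)" .
  moreover have "sU \<mu> w \<in> gen_eigenspace (c + \<delta>)"
    using \<mu>(1) w V.subspace_0[OF subspace_gen_eigenspace]
    by (cases "\<delta> = 0") (auto intro: V.subspace_scale[OF subspace_gen_eigenspace])
  ultimately have "(act u w - sU \<mu> w) + sU \<mu> w \<in> gen_eigenspace (c + \<delta>)"
    by (rule V.subspace_add[OF subspace_gen_eigenspace])
  then show ?thesis by simp
qed

definition eigvec :: "nat \<Rightarrow> 'u" where
  "eigvec k = (SOME e. e \<in> gen_eigenspace (eigval k) \<and> e \<noteq> 0)"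

lemma eigvec: assumes "k < m" shows "eigvec k \<in> gen_eigenspace (eigval k)" "eigvec k \<noteq> 0"
proof -
  obtain e where e: "e \<notin> U k" "e \<in> gen_eigenspace (eigval k)"
    using generalized_eigenvector_exists[OF assms] by blast
  then have "e \<noteq> 0" using V.subspace_0[OF subspace_U[of k]] assms by auto
  then have "\<exists>e. e \<in> gen_eigenspace (eigval k) \<and> e \<noteq> 0" using e by blast
  then have "eigvec k \<in> gen_eigenspace (eigval k) \<and> eigvec k \<noteq> 0" unfolding eigvec_def by (rule someI_ex)
  then show "eigvec k \<in> gen_eigenspace (eigval k)" "eigvec k \<noteq> 0" by auto
qed

lemma zero_on_flag:
  assumes "module_hom sU sU f" and e: "\<And>j. j < m \<Longrightarrow> e j \<in> U (Suc j) \<and> e j \<notin> U j \<and> f (e j) = 0"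
  shows "f w = 0"
proof -
  interpret f: module_hom sU sU f by fact
  have "f w = 0" if "i \<le> m" "w \<in> U i" for i w
    using that
  proof (induction i arbitrary: w)
    case (Suc i)
    then have i: "i < m" by simp
    obtain c r where r: "r \<in> U i" "w = sU c (e i) + r"
      using U_decompose[OF i, of "e i" w thesis] e[OF i] Suc.prems by blast
    have "f r = 0" using Suc r by simp
    then show ?case using r e[OF i] by (simp add: f.add f.scale)
  qed (simp add: f.zero)
  from this[of m w] show ?thesis by (simp add: U_m)
qed

lemma eigvec_U: "k < m \<Longrightarrow> eigvec k \<in> U (Suc k)" "k < m \<Longrightarrow> eigvec k \<notin> U k"
  using eigvec gen_eigenspace_eigval_U gen_eigenspace_eigval_zero by blast+

section \<open>Raising operators\<close>

text \<open>The link between two consecutive factors has weight \<open>step \<noteq> 0\<close>, so it is not \<open>X\<close> but a genuine weight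
  vector.\<close>

lemma raising_exists:
  assumes j: "Suc j < m" shows "\<exists>u\<in>E step. act u (eigvec (Suc j)) \<noteq> 0"
proof -
  obtain \<delta> T where T: "weight_family \<delta> T" "T (eigval (Suc j)) (eigvec (Suc j)) \<notin> U j" "eigval j = eigval (Suc j) + \<delta>"
    by (rule factor_link[OF j eigvec_U(1)[OF j] eigvec_U(2)[OF j] eigvec(1)[OF j]])
  have "\<delta> = step" using T(3) eigval_diff[OF j] by simp
  from T(1) show ?thesis
  proof (cases rule: weight_family_cases)
    case 1 then show ?thesis using \<open>\<delta> = step\<close> step_nonzero by simp
  next
    case (2 u \<mu>)
    have "act u (eigvec (Suc j)) \<noteq> 0"
      using T(2) V.subspace_0[OF subspace_U[of j]] j 2(2,3) \<open>\<delta> = step\<close> step_nonzero by auto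
    then show ?thesis using 2(1) \<open>\<delta> = step\<close> by blast
  qed
qed

text \<open>The image of an eigenvector at level \<open>j\<close> is an eigenvector at some level \<open>k \<le> j\<close>, as \<open>U (Suc j)\<close> is a
  submodule. Comparing eigenvalues gives the weight \<open>(j - k) step\<close>.\<close>

lemma active_weight:
  assumes u: "u \<in> E \<eta>" and act: "act u w \<noteq> 0"
  shows "\<exists>i<m. \<eta> = of_nat i * step"
proof -
  obtain j where j: "j < m" "act u (eigvec j) \<noteq> 0"
    using zero_on_flag[OF act_hom, of eigvec u w] eigvec_U act by blast
  have gen: "act u (eigvec j) \<in> gen_eigenspace (eigval j + \<eta>)" by (rule act_gen_eigenspace[OF u eigvec(1)[OF j(1)]])
  have "act u (eigvec j) \<in> U (Suc j)" using j eigvec_U by (intro act_U) auto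
  then have "\<not> (\<forall>k<Suc j. eigval j + \<eta> \<noteq> eigval k)"
    using gen_eigenspace_descend[OF _ _ gen, of 0 "Suc j"] j by auto
  then obtain k where "k < Suc j" "eigval j + \<eta> = eigval k" by blast
  then have k: "k \<le> j" "eigval j + \<eta> = eigval k" by simp_all
  then have "\<eta> = of_nat (j - k) * step"
    using j eigval_eq[of j] eigval_eq[of k] by (simp add: of_nat_diff algebra_simps)
  then show ?thesis using j by (intro exI[of _ "j - k"]) auto
qed

text \<open>Non-vanishing of \<open>v\<close> spreads from one level to the next in both directions. For \<open>u\<close> linking a
  suitable pair of levels, \<open>u v\<close> and \<open>v u\<close> coincide on an eigenvector, both maps go down one
  eigenline at a time, and one of the two products is visibly non-zero.\<close>

lemma raising_nonzero:
  assumes v: "v \<in> E step" and w: "act v w \<noteq> 0" and j: "Suc j < m"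
  shows "act v (eigvec (Suc j)) \<noteq> 0"
proof -
  have into: "\<exists>c. act u (eigvec (Suc j)) = sU c (eigvec j)" if u: "u \<in> E step" and j: "Suc j < m" for u j
  proof -
    have "act u (eigvec (Suc j)) \<in> gen_eigenspace (eigval j)"
      using act_gen_eigenspace[OF u eigvec(1)[OF j]] eigval_diff[OF j] by simp
    then show ?thesis using gen_eigenspace_line[OF _ eigvec, of j] j by (metis Suc_lessD)
  qed
  have iff: "act v (eigvec (Suc j)) \<noteq> 0 \<longleftrightarrow> act v (eigvec (Suc (Suc j))) \<noteq> 0" if j: "Suc (Suc j) < m" for j
  proof
    assume ne: "act v (eigvec (Suc j)) \<noteq> 0"
    obtain u where u: "u \<in> E step" "act u (eigvec (Suc (Suc j))) \<noteq> 0"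
      using raising_exists[OF j] by blast
    obtain c where c: "act u (eigvec (Suc (Suc j))) = sU c (eigvec (Suc j))" using into[OF u(1) j] by blast
    have "act v (act u (eigvec (Suc (Suc j)))) \<noteq> 0" using c u(2) ne by (auto simp: act_scale)
    then show "act v (eigvec (Suc (Suc j))) \<noteq> 0"
      using weight_commute[OF u(1) v, of "eigvec (Suc (Suc j))"] by auto
  next
    have j': "Suc j < m" using j by simp
    assume ne: "act v (eigvec (Suc (Suc j))) \<noteq> 0"
    obtain u where u: "u \<in> E step" "act u (eigvec (Suc j)) \<noteq> 0"
      using raising_exists[OF j'] by blast
    obtain c where c: "act v (eigvec (Suc (Suc j))) = sU c (eigvec (Suc j))" using into[OF v j] by blast
    obtain d where d: "act u (eigvec (Suc (Suc j))) = sU d (eigvec (Suc j))" using into[OF u(1) j] by blast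
    have "act u (act v (eigvec (Suc (Suc j)))) \<noteq> 0" using c ne u(2) by (auto simp: act_scale)
    then have "act v (act u (eigvec (Suc (Suc j)))) \<noteq> 0"
      using weight_commute[OF u(1) v, of "eigvec (Suc (Suc j))"] by simp
    then show "act v (eigvec (Suc j)) \<noteq> 0" using d by (auto simp: act_scale)
  qed
  have all: "act v (eigvec (Suc j)) \<noteq> 0 \<longleftrightarrow> act v (eigvec (Suc 0)) \<noteq> 0" if "Suc j < m" for j
    using that by (induction j) (use iff in auto)
  have shift: "weight_family step (\<lambda>c. act v)" by (rule weight_family_weight[OF v step_nonzero])
  obtain k where k: "k < m" "act v (eigvec k) \<noteq> 0"
    using zero_on_flag[OF act_hom, of eigvec v w] eigvec_U w by blast
  have "act v (eigvec 0) = 0"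
    using weight_family_lower[OF shift, of 0 "eigvec 0"] eigvec_U(1)[of 0] step_nonzero k(1) by simp
  then have "k \<noteq> 0" using k(2) by metis
  then obtain l where "k = Suc l" by (cases k) auto
  then show ?thesis using all[of l] all[OF j] k by simp
qed

lemma raising_pow:
  assumes v: "v \<in> E step" and w: "act v w \<noteq> 0" and k: "k < m"
  shows "(act v ^^ k) (eigvec (m - 1)) \<in> gen_eigenspace (eigval (m - 1 - k)) \<and> (act v ^^ k) (eigvec (m - 1)) \<noteq> 0"
  using k
proof (induction k)
  case 0
  then show ?case using eigvec[of "m - 1"] by simp
next
  case (Suc k)
  let ?w = "(act v ^^ k) (eigvec (m - 1))"
  define j where "j = m - 1 - Suc k"
  have j: "m - 1 - k = Suc j" "Suc j < m" using Suc.prems by (auto simp: j_def)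
  have IH: "?w \<in> gen_eigenspace (eigval (Suc j))" "?w \<noteq> 0" using Suc j(1) by auto
  obtain c where c: "?w = sU c (eigvec (Suc j))"
    by (rule gen_eigenspace_line[OF j(2) eigvec[OF j(2)] IH(1)])
  have "act v ?w \<in> gen_eigenspace (eigval j)"
    using act_gen_eigenspace[OF v IH(1)] eigval_diff[OF j(2)] by simp
  moreover have "act v ?w \<noteq> 0"
    using c IH(2) raising_nonzero[OF v w j(2)] by (auto simp: act_scale)
  ultimately show ?case by (simp add: j_def)
qed

lemmas act_pow_hom = module_hom_funpow[OF act_hom]

text \<open>After \<open>m - 1\<close> steps the top eigenvector has reached the bottom line \<open>U 1\<close>, which \<open>v\<close> kills.\<close>

lemma raising_pow_top:
  assumes v: "v \<in> E step" and w: "act v w \<noteq> 0" and n: "m \<le> n"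
  shows "(act v ^^ n) (eigvec (m - 1)) = 0"
proof -
  let ?w = "(act v ^^ (m - 1)) (eigvec (m - 1))"
  have m0: "0 < m" using m_gt_1 by simp
  have "?w \<in> U (Suc 0)"
    using raising_pow[OF v w, of "m - 1"] m0 by (intro gen_eigenspace_eigval_U[OF m0]) simp
  then have "act v ?w = 0"
    using weight_family_lower[OF weight_family_weight[OF v step_nonzero] m0, of ?w] step_nonzero by simp
  then have zero: "(act v ^^ m) (eigvec (m - 1)) = 0"
    using m0 by (cases m) simp_all
  have "n = (n - m) + m" using n by simp
  then show ?thesis using zero module_hom.zero[OF act_pow_hom] by (metis funpow_add o_apply)
qed

section \<open>Every weight vector acts as a multiple of a power\<close>

text \<open>The scalar \<open>c\<close> with \<open>u = c v ^ i\<close> on the module, read off on the top eigenvector. It is unique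
  for \<open>i < m\<close>, when \<open>v ^ i\<close> does not kill that vector.\<close>

definition power_coeff :: "'g \<Rightarrow> nat \<Rightarrow> 'g \<Rightarrow> 'f" where
  "power_coeff v i u = (THE c. act u (eigvec (m - 1)) = sU c ((act v ^^ i) (eigvec (m - 1))))"

lemma power_coeff_eqI:
  assumes v: "v \<in> E step" and w: "act v w \<noteq> 0" and i: "i < m"
    and c: "act u (eigvec (m - 1)) = sU c ((act v ^^ i) (eigvec (m - 1)))"
  shows "power_coeff v i u = c"
  unfolding power_coeff_def using c raising_pow[OF v w i] by (intro the_equality) auto

lemma act_top:
  assumes v: "v \<in> E step" and w: "act v w \<noteq> 0" and i: "i < m" and u: "u \<in> E (of_nat i * step)"
  shows "act u (eigvec (m - 1)) = sU (power_coeff v i u) ((act v ^^ i) (eigvec (m - 1)))"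
proof -
  have "act u (eigvec (m - 1)) \<in> gen_eigenspace (eigval (m - 1 - i))"
    using act_gen_eigenspace[OF u eigvec(1)[of "m - 1"]] eigval_shift[of i "m - 1"] i by simp
  then obtain c where c: "act u (eigvec (m - 1)) = sU c ((act v ^^ i) (eigvec (m - 1)))"
    using raising_pow[OF v w i] i by (elim gen_eigenspace_line[rotated 3, where k = "m - 1 - i"]) auto
  then show ?thesis using power_coeff_eqI[OF v w i c] by simp
qed

lemma power_coeff_functional:
  assumes v: "v \<in> E step" and w: "act v w \<noteq> 0" and i: "i < m"
  shows "L.functional_on (E (of_nat i * step)) (power_coeff v i)"
  unfolding L.functional_on_def
proof (intro conjI ballI allI)
  note top = act_top[OF v w i]
  fix u assume u: "u \<in> E (of_nat i * step)"
  show "power_coeff v i (sg c u) = c * power_coeff v i u" for c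
    by (rule power_coeff_eqI[OF v w i]) (simp add: act_scale_left top[OF u] del: One_nat_def)
  fix u' assume u': "u' \<in> E (of_nat i * step)"
  show "power_coeff v i (u + u') = power_coeff v i u + power_coeff v i u'"
    by (rule power_coeff_eqI[OF v w i]) (simp add: act_add_left top[OF u] top[OF u'] V.scale_left_distrib del: One_nat_def)
qed

lemma power_coeff_self:
  assumes v: "v \<in> E step" and w: "act v w \<noteq> 0"
  shows "power_coeff v 1 v = 1"
  by (rule power_coeff_eqI[OF v w]) (use m_gt_1 in simp_all)

text \<open>Indexed from the bottom of the flag, so that \<open>v\<close> lowers the index by one.\<close>

definition raising_basis :: "'g \<Rightarrow> nat \<Rightarrow> 'u" where
  "raising_basis v j = (act v ^^ (m - 1 - j)) (eigvec (m - 1))"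

lemma raising_basis_gen_eigenspace:
  assumes v: "v \<in> E step" and w: "act v w \<noteq> 0" and j: "j < m"
  shows "raising_basis v j \<in> gen_eigenspace (eigval j)" "raising_basis v j \<noteq> 0"
  using raising_pow[OF v w, of "m - 1 - j"] j by (auto simp: raising_basis_def)

text \<open>The vector \<open>raising_basis v j\<close> is a power of \<open>v\<close> applied to the top eigenvector, and \<open>u\<close> commutes
  with \<open>v\<close>. So it suffices to know \<open>u\<close> on the top eigenvector.\<close>

lemma act_raising_basis:
  assumes v: "v \<in> E step" and w: "act v w \<noteq> 0" and i: "i < m" and u: "u \<in> E (of_nat i * step)"
    and j: "j < m"
  shows "act u (raising_basis v j) = (if i \<le> j then sU (power_coeff v i u) (raising_basis v (j - i)) else 0)"
proof -
  have comm: "act u ((act v ^^ n) w) = (act v ^^ n) (act u w)" for n w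
    by (induction n) (simp_all add: weight_commute[OF u v])
  have "act u (raising_basis v j) = sU (power_coeff v i u) ((act v ^^ (m - 1 - j + i)) (eigvec (m - 1)))"
    by (simp add: raising_basis_def comm act_top[OF v w i u] module_hom.scale[OF act_pow_hom] funpow_add
        del: One_nat_def)
  moreover have "m - 1 - j + i = m - 1 - (j - i)" if "i \<le> j" using that j by simp
  moreover have "(act v ^^ (m - 1 - j + i)) (eigvec (m - 1)) = 0" if "\<not> i \<le> j"
    using that j by (intro raising_pow_top[OF v w]) simp
  ultimately show ?thesis by (simp add: raising_basis_def)
qed

lemma power_coeff_zero:
  assumes v: "v \<in> E step" and w: "act v w \<noteq> 0" and i: "i < m" and u: "u \<in> E (of_nat i * step)"
  shows "power_coeff v i u = 0 \<longleftrightarrow> (\<forall>w. act u w = 0)"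
proof
  assume 0: "power_coeff v i u = 0"
  show "\<forall>w. act u w = 0"
  proof
    fix w'
    show "act u w' = 0"
    proof (rule zero_on_flag[OF act_hom, of "raising_basis v"])
      fix j assume j: "j < m"
      note gen = raising_basis_gen_eigenspace[OF v w j]
      show "raising_basis v j \<in> U (Suc j) \<and> raising_basis v j \<notin> U j \<and> act u (raising_basis v j) = 0"
        using gen_eigenspace_eigval_U[OF j gen(1)] gen_eigenspace_eigval_zero[OF j gen(1)]
          gen(2) act_raising_basis[OF v w i u j] 0 by auto
    qed
  qed
next
  assume "\<forall>w. act u w = 0"
  then show "power_coeff v i u = 0" by (intro power_coeff_eqI[OF v w i]) simp
qed

section \<open>Matrices and rescaling\<close>

lemma flag_basis:
  assumes e: "\<And>j. j < m \<Longrightarrow> e j \<in> U (Suc j) \<and> e j \<notin> U j"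
  shows "V.ordered_basis (map e [0..<m])"
proof -
  have "distinct (map e [0..<k]) \<and> V.independent (e ` {..<k}) \<and> V.span (e ` {..<k}) = U k"
    if "k \<le> m" for k
    using that
  proof (induction k)
    case (Suc k)
    then have k: "k < m" and IH: "distinct (map e [0..<k])" "V.independent (e ` {..<k})"
      "V.span (e ` {..<k}) = U k" by auto
    have notin: "e k \<notin> V.span (e ` {..<k})" using e[OF k] IH(3) by simp
    have "U (Suc k) = V.span (insert (e k) (e ` {..<k}))"
      using U_Suc[OF k, of "e k"] e[OF k] by (simp add: line_extension_def V.span_insert IH(3))
    moreover have "e k \<notin> e ` {..<k}" by (rule contra_subsetD[OF V.span_superset notin])
    moreover have "e ` {..<Suc k} = insert (e k) (e ` {..<k})" by (simp add: lessThan_Suc)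
    moreover have "V.independent (insert (e k) (e ` {..<k}))"
      by (rule V.independent_insertI[OF notin IH(2)])
    ultimately show ?case
      using IH(1) by (simp add: atLeast0LessThan)
  qed (simp add: V.independent_empty)
  from this[of m] show ?thesis
    by (simp add: V.ordered_basis_def U_m atLeast0LessThan)
qed

lemma represented_mapI:
  assumes M: "M \<in> carrier_mat m m"
    and T: "\<And>j. j < m \<Longrightarrow> T (e j) = (\<Sum>i<m. sU (M $$ (i, j)) (e i))"
  shows "V.represented_by (map e [0..<m]) T M"
  using assms by (simp add: V.represented_by_def)

lemma sum_single: "j < m \<Longrightarrow> (\<Sum>i<m. sU (if i = j then c else 0) (e i)) = sU c (e j)"
  by (subst sum.mono_neutral_right[of _ "{j}"]) auto

lemma raising_basis_ordered_basis:
  assumes v: "v \<in> E step" and w: "act v w \<noteq> 0"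
  shows "V.ordered_basis (map (raising_basis v) [0..<m])"
  using raising_basis_gen_eigenspace[OF v w] gen_eigenspace_eigval_U gen_eigenspace_eigval_zero
  by (intro flag_basis) blast

lemma raising_basis_represents_weight:
  assumes v: "v \<in> E step" and w: "act v w \<noteq> 0" and i: "i < m" and u: "u \<in> E (of_nat i * step)"
  shows "V.represented_by (map (raising_basis v) [0..<m]) (act u)
    (power_coeff v i u \<cdot>\<^sub>m (jordan_block m 0 ^\<^sub>m i))"
proof (rule represented_mapI)
  let ?c = "power_coeff v i u"
  show "?c \<cdot>\<^sub>m (jordan_block m 0 ^\<^sub>m i) \<in> carrier_mat m m" by simp
  fix j assume j: "j < m"
  \<comment> \<open>In the binomial formula for powers of a Jordan block, eigenvalue \<open>0\<close> leaves only the entries with \<open>j = r + i\<close>.\<close>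
  have entry: "(?c \<cdot>\<^sub>m (jordan_block m 0 ^\<^sub>m i)) $$ (r, j) = (if r + i = j then ?c else 0)"
    if "r < m" for r
    using that j by (cases "r + i < j") (auto simp: jordan_block_pow binomial_eq_0)
  have "(\<Sum>r<m. sU ((?c \<cdot>\<^sub>m (jordan_block m 0 ^\<^sub>m i)) $$ (r, j)) (raising_basis v r)) =
      (\<Sum>r<m. sU (if r + i = j then ?c else 0) (raising_basis v r))"
    by (intro sum.cong) (simp_all only: entry lessThan_iff)
  also have "\<dots> = (if i \<le> j then sU ?c (raising_basis v (j - i)) else 0)"
  proof (cases "i \<le> j")
    case True
    then have "r + i = j \<longleftrightarrow> r = j - i" for r by auto
    then show ?thesis using True j sum_single[of "j - i" ?c] by simp
  next
    case False
    then have "r + i \<noteq> j" for r by auto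
    then show ?thesis using False by simp
  qed
  also have "\<dots> = act u (raising_basis v j)" by (rule act_raising_basis[OF v w i u j, symmetric])
  finally show "act u (raising_basis v j) =
      (\<Sum>r<m. sU ((?c \<cdot>\<^sub>m (jordan_block m 0 ^\<^sub>m i)) $$ (r, j)) (raising_basis v r))" by simp
qed

abbreviation x' :: 'g where
  "x' \<equiv> sg (inverse step) x"

text \<open>Dividing \<open>x\<close> by \<open>step\<close> divides all weights by \<open>step\<close>, so that \<open>of_nat i * step\<close> becomes \<open>of_nat i\<close>.\<close>

lemma rescaled_eigenspace: "L.ad_eigenspace A x' \<delta> = E (\<delta> * step)"
proof -
  have br: "br x' v = sg (inverse step) (br x v)" for v
    using L.br_linear_left[of v] by (intro module_hom.scale[OF Vector_Spaces.linear.axioms(3)])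
  have "sg (inverse step) w = sg \<delta> v \<longleftrightarrow> w = sg (\<delta> * step) v" for v w
  proof
    assume "sg (inverse step) w = sg \<delta> v"
    then have "sg step (sg (inverse step) w) = sg step (sg \<delta> v)" by simp
    then show "w = sg (\<delta> * step) v" using step_nonzero by (simp add: mult.commute)
  next
    assume "w = sg (\<delta> * step) v"
    then show "sg (inverse step) w = sg \<delta> v" using step_nonzero by (simp add: mult.commute)
  qed
  then show ?thesis by (simp add: L.ad_eigenspace_def br)
qed

lemma raising_basis_represents_x:
  assumes v: "v \<in> E step" and w: "act v w \<noteq> 0"
  shows "V.represented_by (map (raising_basis v) [0..<m]) (act x')
    (mat_diag m (\<lambda>j. eigval 0 / step - of_nat j))"
proof (rule represented_mapI)
  let ?d = "\<lambda>j. eigval 0 / step - of_nat j"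
  fix j assume j: "j < m"
  have "(\<Sum>i<m. sU (mat_diag m ?d $$ (i, j)) (raising_basis v i)) =
      (\<Sum>i<m. sU (if i = j then ?d j else 0) (raising_basis v i))"
    using j by (intro sum.cong) (auto simp: mat_diag_def)
  also have "\<dots> = sU (?d j) (raising_basis v j)" by (rule sum_single[OF j])
  also have "?d j = inverse step * eigval j"
    using step_nonzero eigval_eq[OF j] by (simp add: field_simps)
  also have "sU \<dots> (raising_basis v j) = act x' (raising_basis v j)"
    using gen_eigenspace_eigval_eigen[OF j raising_basis_gen_eigenspace(1)[OF v w j]] by (simp add: act_scale_left)
  finally show "act x' (raising_basis v j) = (\<Sum>i<m. sU (mat_diag m ?d $$ (i, j)) (raising_basis v i))" by simp
qed simp

lemma raising_element: "\<exists>v w. v \<in> E step \<and> act v w \<noteq> 0"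
  using raising_exists[of 0] m_gt_1 by auto

lemma active_eigenvalues_rescaled:
  "\<delta> \<in> active_eigenvalues A x' \<longleftrightarrow> (\<exists>u\<in>E (\<delta> * step). \<exists>w. act u w \<noteq> 0)"
proof -
  have "u \<noteq> 0" if "act u w \<noteq> 0" for u w using that by auto
  then show ?thesis
    unfolding active_eigenvalues_def L.ad_eigenvalue_def acts_trivially_def rescaled_eigenspace
    by blast
qed

lemma active_eigenvalue_of_nat:
  assumes "\<delta> \<in> active_eigenvalues A x'"
  shows "\<exists>i<m. \<delta> = of_nat i"
  using assms active_weight step_nonzero by (fastforce simp: active_eigenvalues_rescaled)

text \<open>The annihilator is the kernel of the functional \<open>power_coeff v i\<close>, which does not vanish since
  \<open>\<delta>\<close> is active.\<close>

lemma annihilator_hyperplane: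
  assumes "fin_dim sg" and \<delta>: "\<delta> \<in> active_eigenvalues A x'"
  shows "L.hyperplane_of (eigenspace_annihilator A x' \<delta>) (L.ad_eigenspace A x' \<delta>)"
proof -
  obtain Bg where "finite_dimensional_vector_space sg Bg" using assms(1) by (auto simp: fin_dim_def)
  then interpret FL: finite_dimensional_vector_space sg Bg .
  obtain i where i: "i < m" "\<delta> = of_nat i" using active_eigenvalue_of_nat[OF \<delta>] by blast
  obtain v w where v: "v \<in> E step" and w: "act v w \<noteq> 0" using raising_element by blast
  obtain u w' where u: "u \<in> E (of_nat i * step)" "act u w' \<noteq> 0"
    using \<delta> i(2) by (auto simp: active_eigenvalues_rescaled)
  have "power_coeff v i u \<noteq> 0" using power_coeff_zero[OF v w i(1) u(1)] u(2) by blast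
  from FL.kernel_hyperplane[OF subspace_eigenspace power_coeff_functional[OF v w i(1)] u(1) this]
  have "L.hyperplane_of {u \<in> E (of_nat i * step). power_coeff v i u = 0} (E (of_nat i * step))" .
  moreover have "{u \<in> E (of_nat i * step). power_coeff v i u = 0} = eigenspace_annihilator A x' \<delta>"
    using power_coeff_zero[OF v w i(1)] by (auto simp: eigenspace_annihilator_def rescaled_eigenspace i(2))
  ultimately show ?thesis by (simp add: rescaled_eigenspace i(2))
qed

lemma faithful_multiplicity_one:
  assumes "fin_dim sg" and faithful: "faithful" and \<delta>: "L.ad_eigenvalue A x' \<delta>"
  shows "L.dim (L.ad_eigenspace A x' \<delta>) = 1"
proof -
  have "\<delta> \<in> active_eigenvalues A x'"
    using \<delta> faithful unfolding active_eigenvalues_def acts_trivially_def faithful_def L.ad_eigenvalue_def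
    by blast
  then have hyp: "L.hyperplane_of (eigenspace_annihilator A x' \<delta>) (L.ad_eigenspace A x' \<delta>)"
    by (rule annihilator_hyperplane[OF assms(1)])
  obtain Bg where "finite_dimensional_vector_space sg Bg" using assms(1) by (auto simp: fin_dim_def)
  then interpret FL: finite_dimensional_vector_space sg Bg .
  have "eigenspace_annihilator A x' \<delta> \<subseteq> {0}"
    using faithful by (auto simp: eigenspace_annihilator_def faithful_def)
  then have "L.dim (eigenspace_annihilator A x' \<delta>) = 0" by (simp add: FL.dim_eq_0)
  then show ?thesis using hyp by (simp add: L.hyperplane_of_def)
qed

end

section \<open>The structure theorem\<close>

theorem theorem3p4:
  fixes sg :: "'f::alg_closed_field \<Rightarrow> 'g::ab_group_add \<Rightarrow> 'g"
    and br :: "'g \<Rightarrow> 'g \<Rightarrow> 'g"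
    and sU :: "'f \<Rightarrow> 'u::ab_group_add \<Rightarrow> 'u"
    and act :: "'g \<Rightarrow> 'u \<Rightarrow> 'u"
    and x :: 'g and A :: "'g set" and m :: nat
  assumes module: "lie_module sg br sU act"
    and fin_g: "fin_dim sg"
    and semidirect: "lie_algebra.line_semidirect sg br x A"
    and diagonalizable: "lie_algebra.ad_diagonalizable_on sg br x A"
    and fin_U: "fin_dim sU"
    and admissible: "lie_module.admissible sg br act"
    and uniserial: "lie_module.uniserial sU act"
    and length: "lie_module.has_composition_length sU act m"
    and nontrivial: "\<not> lie_module.acts_trivially act (lie_algebra.derived_algebra sg br)"
    and char: "CHAR('f) = 0 \<or> (prime CHAR('f) \<and> m \<le> CHAR('f))"
  shows "m = vector_space.dim sU UNIV \<and> m > 1 \<and>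
    (\<exists>c x'. c \<noteq> 0 \<and> x' = sg c x \<and>
      1 \<in> lie_module.active_eigenvalues sg br act A x' \<and>
      (\<forall>\<delta>\<in>lie_module.active_eigenvalues sg br act A x'. \<exists>i<m. \<delta> = of_nat i) \<and>
      (\<forall>i\<in>lie_module.active_eigenvalues sg br act A x'.
        vector_space.hyperplane_of sg
          (lie_module.eigenspace_annihilator sg br act A x' i)
          (lie_algebra.ad_eigenspace sg br A x' i)) \<and>
      (lie_module.faithful act \<longrightarrow>
        (\<forall>\<delta>. lie_algebra.ad_eigenvalue sg br A x' \<delta> \<longrightarrow>
          vector_space.dim sg (lie_algebra.ad_eigenspace sg br A x' \<delta>) = 1)) \<and>
      (\<forall>v\<in>lie_algebra.ad_eigenspace sg br A x' 1.
        v \<noteq> 0 \<and> v \<notin> lie_module.eigenspace_annihilator sg br act A x' 1 \<longrightarrow>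
        (\<exists>(f :: nat \<Rightarrow> 'g \<Rightarrow> 'f) es \<alpha>.
          (\<forall>i<m. vector_space.functional_on sg
             (lie_algebra.ad_eigenspace sg br A x' (of_nat i)) (f i)) \<and>
          f 1 v = 1 \<and>
          vector_space.ordered_basis sU es \<and>
          vector_space.represented_by sU es (act x') (mat_diag m (\<lambda>j. \<alpha> - of_nat j)) \<and>
          (\<forall>i<m. \<forall>u\<in>lie_algebra.ad_eigenspace sg br A x' (of_nat i).
             vector_space.represented_by sU es (act u) (f i u \<cdot>\<^sub>m (jordan_block m 0 ^\<^sub>m i))))))"
proof -
  interpret M: lie_module sg br sU act by (rule module)
  obtain BU where BU: "finite_dimensional_vector_space sU BU" using fin_U by (auto simp: fin_dim_def)
  obtain Ws where Ws: "M.composition_series Ws" "length Ws = Suc m"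
    using length by (auto simp: M.has_composition_length_def)
  have split: "split_module sg br sU act BU x A"
    by (intro split_module.intro split_module_axioms.intro module BU semidirect diagonalizable admissible)
  have flag: "M.maximal_flag m ((!) Ws)"
    using Ws by (simp add: M.composition_series_iff)
  have unique: "U' i = Ws ! i" if U': "M.maximal_flag m U'" and i: "i \<le> m" for U' i
  proof -
    \<comment> \<open>A maximal flag, listed up to index \<open>m\<close>, is a composition series, so uniseriality transfers to flags.\<close>
    let ?Vs = "map U' [0..<Suc m]"
    have nth: "?Vs ! k = U' k" if "k \<le> m" for k using that by (simp del: upt_Suc)
    have "M.maximal_flag m ((!) ?Vs)"
      using U' unfolding M.maximal_flag_def by (simp add: nth del: upt_Suc)
    then have "M.composition_series ?Vs" by (simp add: M.composition_series_iff)
    then have "?Vs = Ws" using uniserial Ws(1) by (auto simp: M.uniserial_def)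
    then show ?thesis using nth[OF i] by simp
  qed
  have char': "CHAR('f) = 0 \<or> m \<le> CHAR('f)" using char by blast
  interpret ladder_module sg br sU act BU x A m "(!) Ws"
    by (intro ladder_module.intro uniserial_module.intro uniserial_module_axioms.intro
        ladder_module_axioms.intro split flag unique nontrivial char')
  have E1: "M.L.ad_eigenspace A x' 1 = E step" by (simp add: rescaled_eigenspace)
  have m: "m = M.V.dim UNIV" using dim_U[of m] by (simp add: U_m)
  show ?thesis
  proof (intro conjI exI[of _ "inverse step"] exI[of _ x'] ballI impI allI m m_gt_1)
    show "inverse step \<noteq> 0" using step_nonzero by simp
    show "x' = sg (inverse step) x" by simp
    show "1 \<in> M.active_eigenvalues A x'"
      using raising_element by (auto simp: active_eigenvalues_rescaled)
    show "\<exists>i<m. \<delta> = of_nat i" if "\<delta> \<in> M.active_eigenvalues A x'" for \<delta>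
      using that by (rule active_eigenvalue_of_nat)
    show "M.L.hyperplane_of (M.eigenspace_annihilator A x' i) (M.L.ad_eigenspace A x' i)"
      if "i \<in> M.active_eigenvalues A x'" for i
      by (rule annihilator_hyperplane[OF fin_g that])
    show "M.L.dim (M.L.ad_eigenspace A x' \<delta>) = 1" if "M.faithful" "M.L.ad_eigenvalue A x' \<delta>" for \<delta>
      by (rule faithful_multiplicity_one[OF fin_g that])
    fix v assume v: "v \<in> M.L.ad_eigenspace A x' 1" "v \<noteq> 0 \<and> v \<notin> M.eigenspace_annihilator A x' 1"
    have vE: "v \<in> E step" using v(1) E1 by simp
    obtain w where w: "act v w \<noteq> 0" using v by (auto simp: M.eigenspace_annihilator_def)
    show "\<exists>f es \<alpha>.
          (\<forall>i<m. M.L.functional_on (M.L.ad_eigenspace A x' (of_nat i)) (f i)) \<and>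
          f 1 v = 1 \<and> M.V.ordered_basis es \<and>
          M.V.represented_by es (act x') (mat_diag m (\<lambda>j. \<alpha> - of_nat j)) \<and>
          (\<forall>i<m. \<forall>u\<in>M.L.ad_eigenspace A x' (of_nat i).
             M.V.represented_by es (act u) (f i u \<cdot>\<^sub>m (jordan_block m 0 ^\<^sub>m i)))"
      unfolding rescaled_eigenspace
      using power_coeff_functional[OF vE w] power_coeff_self[OF vE w] raising_basis_ordered_basis[OF vE w]
        raising_basis_represents_x[OF vE w] raising_basis_represents_weight[OF vE w]
      by (intro exI[of _ "power_coeff v"] exI[of _ "map (raising_basis v) [0..<m]"] exI[of _ "eigval 0 / step"]) simp
  qed
qed

end
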